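(* Let $p(x)$ be a real polynomial of even degree with positive leading coefficient, and let $p(x,t)$ be its heat evolution. Let $t_0>0$ be such that $x\mapsto p(x,t_0)$ is convex, and let $x^{t_0}_{\min}$ be the global minimizer of $x\mapsto p(x,t_0)$. Let $x^*$ be the global minimizer of $p(x)$. Then $x^*$ can be inversely evolved from the global minimizer of $p(x,t_0)$, i.e. the trajectory of the Yuille–Poggio equation through $(x^{t_0}_{\min},t_0)$, followed backward in $t$ from $t=t_0$ to $t=0$, has endpoint $x^*$ at $t=0$, if and only if $x^*$ lies in the escape zone $\Omega^c$ of $p$.
   Context: Heat evolution: $p(x,t)=(p*g_t)(x)$ for $t>0$ with $g_t(x)=\frac{1}{\sqrt{2\pi t}}e^{-x^2/(2t)}$, and $p(x,0)=p(x)$; equivalently $p(x,t)$ solves $\frac{\partial p}{\partial t}=\frac12\frac{\partial^2 p}{\partial x^2}$ with $p(x,0)=p(x)$, so $p(x,t)=\sum_{k\ge 0}\frac{t^k}{2^k k!}p^{(2k)}(x)$. Yuille–Poggio equation (trajectory equation): $\displaystyle \frac{dx(t)}{dt}=-\frac{\frac{\partial^3 p}{\partial x^3}(x(t),t)}{2\,\frac{\partial^2 p}{\partial x^2}(x(t),t)}$. It is the equation satisfied by curves along which $\frac{\partial p}{\partial x}(x(t),t)$ is constant. It is singular where $\frac{\partial^2 p}{\partial x^2}=0$. For $h\in\mathbb{R}$, the Yuille–Poggio curve from $(h,0)$ is the integral curve $(x(t),t)$, $t\ge0$, of this equation with $x(0)=h$. Two such curves may meet at a point where $\frac{\partial^2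 p}{\partial x^2}=0$ (a limiting endpoint of both curves); this counts as an intersection. Escape and confinement zones: $c\in\mathbb{R}$ is in the escape zone $\Omega^c$ if the Yuille–Poggio curve from $(c,0)$ does not intersect any Yuille–Poggio curve from a point $(c',0)\neq(c,0)$. Otherwise $c$ is in the confinement zone $\Omega$. *)

theory Defs
  imports "HOL-Analysis.Analysis" "HOL-Computational_Algebra.Polynomial"
begin

definition heat_kernel :: "real \<Rightarrow> real \<Rightarrow> real" where
  "heat_kernel t x = 1 / sqrt (2 * pi * t) * exp (- x\<^sup>2 / (2 * t))"

text \<open>\<open>heat p x t\<close> is $p(x,t)$. Only $t \ge 0$ is meaningful; negative times get a dummy value.\<close>

definition heat :: "real poly \<Rightarrow> real \<Rightarrow> real \<Rightarrow> real" where
  "heat p x t = (if t > 0 then (\<integral>y. poly p y * heat_kernel t (x - y) \<partial>lborel) else poly p x)"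

text \<open>The \<open>n\<close>-th partial derivative in the space variable.\<close>

definition heat_dx :: "nat \<Rightarrow> real poly \<Rightarrow> real \<Rightarrow> real \<Rightarrow> real" where
  "heat_dx n p x t = (deriv ^^ n) (\<lambda>\<xi>. heat p \<xi> t) x"

text \<open>Classical solutions of the Yuille--Poggio equation on a set of times \<open>I\<close>. They avoid the
  singular set, where the second space derivative vanishes (and where the quotient below would
  silently evaluate to 0).\<close>

definition yp_solution :: "real poly \<Rightarrow> (real \<Rightarrow> real) \<Rightarrow> real set \<Rightarrow> bool" where
  "yp_solution p x I \<longleftrightarrow>
     (\<forall>t\<in>I. heat_dx 2 p (x t) t \<noteq> 0 \<and>
        (x has_real_derivative - heat_dx 3 p (x t) t / (2 * heat_dx 2 p (x t) t)) (at t within I))"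

text \<open>Integral curves on the closed interval from \<open>0\<close> to \<open>T\<close>. A finite set \<open>S\<close> of exceptional
  times is allowed, at which the curve need only be continuous. This admits a singular starting
  point (e.g. $x(t) = 0$ for $p = x^4$), a singular limiting endpoint at time \<open>T\<close>, and a curve that
  continues through an isolated singular point. As \<open>S\<close> is finite, the first space derivative
  of $p(x,t)$ is still constant along such a curve.\<close>

definition yp_path :: "real poly \<Rightarrow> (real \<Rightarrow> real) \<Rightarrow> real \<Rightarrow> bool" where
  "yp_path p x T \<longleftrightarrow>
     continuous_on {0..T} x \<and> (\<exists>S. finite S \<and> yp_solution p x ({0..T} - S))"

text \<open>The Yuille--Poggio curve from $(h,0)$, as a subset of the $(x,t)$ plane: every point that can
  be reached from $(h,0)$, including a limiting endpoint of the curve.\<close>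

definition yp_curve :: "real poly \<Rightarrow> real \<Rightarrow> (real \<times> real) set" where
  "yp_curve p h = {(x T, T) | x T. 0 \<le> T \<and> x 0 = h \<and> yp_path p x T}"

definition escape_zone :: "real poly \<Rightarrow> real set" where
  "escape_zone p = {c. \<forall>c'. c' \<noteq> c \<longrightarrow> yp_curve p c \<inter> yp_curve p c' = {}}"

definition confinement_zone :: "real poly \<Rightarrow> real set" where
  "confinement_zone p = - escape_zone p"

text \<open>The trajectory through $(\xi,t_0)$, followed backward, stays regular on $(0,t_0]$ and has
  endpoint \<open>a\<close> at time \<open>0\<close>. The endpoint is a limit, since $(a,0)$ itself may be singular.\<close>

definition yp_inverse_evolution :: "real poly \<Rightarrow> real \<Rightarrow> real \<Rightarrow> real \<Rightarrow> bool" where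
  "yp_inverse_evolution p \<xi> t0 a \<longleftrightarrow>
     (\<exists>x. yp_solution p x {0<..t0} \<and> x t0 = \<xi> \<and> (x \<longlongrightarrow> a) (at_right 0))"

text \<open>\<open>a\<close> is \<^emph>\<open>the\<close> global minimizer of \<open>f\<close>, i.e. the unique one.\<close>

definition the_global_minimizer :: "(real \<Rightarrow> real) \<Rightarrow> real \<Rightarrow> bool" where
  "the_global_minimizer f a \<longleftrightarrow> (\<forall>y. y \<noteq> a \<longrightarrow> f a < f y)"

end

theory Submission
  imports Defs "HOL-Probability.Distributions"
begin

text \<open>
  Along a Yuille--Poggio curve \<open>u = p\<^sub>x\<close> is constant, so the curves meeting the one from the
  minimizer are exactly the zero curves of \<open>u\<close>, a polynomial solution of the heat equation in
  \<open>x\<close> and \<open>t\<close>. By the maximum principle two zero curves starting at the same point coincide as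
  long as both exist, whereas zero curves can merge at points where \<open>u = u\<^sub>x = 0\<close>. Parabolic
  blow-up at such a singular point, whose limit is a nonzero multiple of a heat polynomial \<open>h\<^sub>m\<close>
  with \<open>m \<ge> 2\<close>, shows that singular points are isolated and that at least two zero curves come in
  from the past. Between singular times the zeros are continuous branches, so every zero can be
  traced back to time \<open>0\<close>.

  Hence, if the minimizer is in the escape zone, its zero curve never hits a singular point: a
  second branch arriving there would come from another starting point. The curve therefore reaches
  time \<open>t\<^sub>0\<close> at the only zero of \<open>u\<close>. Conversely, along a curve on which \<open>u\<^sub>x \<noteq> 0\<close> for
  \<open>0 < t \<le> t\<^sub>0\<close> zeros are locally unique, so no other curve can join it before \<open>t\<^sub>0\<close>, and any
  meeting after \<open>t\<^sub>0\<close> forces one at \<open>t\<^sub>0\<close>, where convexity leaves only one zero.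
\<close>

section \<open>Heat flow of polynomials\<close>

text \<open>This is exp((t/2) D^2) applied to \<open>q\<close>. The series terminates: terms with 2k
  above the degree vanish, so the cut-off \<open>degree q\<close> is generous. The formula makes
  sense for negative \<open>t\<close> too, which allows looking backward in time from any
  point.\<close>

definition heat_poly :: "real poly \<Rightarrow> real \<Rightarrow> real poly" where
  "heat_poly q t = (\<Sum>k\<le>degree q. smult (t ^ k / (2 ^ k * fact k)) ((pderiv ^^ (2 * k)) q))"

lemma higher_pderiv_eq_0:
  fixes q :: "'a::{comm_semiring_1,semiring_no_zero_divisors,semiring_char_0} poly"
  assumes "degree q < n"
  shows "(pderiv ^^ n) q = 0"
  using assms by (intro poly_eqI) (simp add: coeff_higher_pderiv coeff_eq_0)

lemma smult_sum_right: "smult c (\<Sum>i\<in>A. f i) = (\<Sum>i\<in>A. smult c (f i))"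
  by (induction A rule: infinite_finite_induct) (simp_all add: smult_add_right)

text \<open>A freely chosen cut-off lets sums belonging to different polynomials be compared term by
  term.\<close>

lemma heat_poly_eq_sum:
  assumes "degree q \<le> N"
  shows "heat_poly q t = (\<Sum>k\<le>N. smult (t ^ k / (2 ^ k * fact k)) ((pderiv ^^ (2 * k)) q))"
  unfolding heat_poly_def
  using assms by (intro sum.mono_neutral_left) (auto simp: higher_pderiv_eq_0)

lemma heat_poly_time_0 [simp]: "heat_poly q 0 = q"
  unfolding heat_poly_def
  by (subst sum.mono_neutral_right[of _ "{0}"]) auto

lemma heat_poly_0 [simp]: "heat_poly 0 t = 0"
  by (simp add: heat_poly_def)

lemma heat_poly_add: "heat_poly (q + r) t = heat_poly q t + heat_poly r t"
proof -
  define N where "N = max (degree q) (degree r)"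
  have "degree (q + r) \<le> N" "degree q \<le> N" "degree r \<le> N"
    by (simp_all add: N_def degree_add_le_max)
  then show ?thesis
    by (simp add: heat_poly_eq_sum[of _ N] higher_pderiv_add smult_add_right sum.distrib)
qed

lemma heat_poly_smult: "heat_poly (smult c q) t = smult c (heat_poly q t)"
proof -
  have "degree (smult c q) \<le> degree q" by (rule degree_smult_le)
  then show ?thesis
    by (simp add: heat_poly_eq_sum[of _ "degree q"] higher_pderiv_smult smult_sum_right mult.commute)
qed

lemma heat_poly_minus [simp]: "heat_poly (- q) t = - heat_poly q t"
  using heat_poly_smult[of "-1" q t] by simp

lemma heat_poly_sum: "heat_poly (\<Sum>i\<in>A. f i) t = (\<Sum>i\<in>A. heat_poly (f i) t)"
  by (induction A rule: infinite_finite_induct) (simp_all add: heat_poly_add)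

lemma pderiv_heat_poly: "pderiv (heat_poly q t) = heat_poly (pderiv q) t"
proof -
  have *: "pderiv ((pderiv ^^ k) q) = (pderiv ^^ k) (pderiv q)" for k
    by (simp add: funpow_swap1)
  have "degree (pderiv q) \<le> degree q" by (simp add: degree_pderiv)
  then show ?thesis
    by (simp add: heat_poly_eq_sum[of _ "degree q"] higher_pderiv_sum[where n = 1, simplified] pderiv_smult *)
qed

lemma higher_pderiv_heat_poly: "(pderiv ^^ n) (heat_poly q t) = heat_poly ((pderiv ^^ n) q) t"
  by (induction n) (simp_all add: pderiv_heat_poly)

lemma poly_heat_poly_has_field_derivative_time:
  "((\<lambda>t. poly (heat_poly q t) x) has_real_derivative
      poly (heat_poly (pderiv (pderiv q)) t) x / 2) (at t)"
proof -
  let ?c = "\<lambda>k t. t ^ k / (2 ^ k * fact k) :: real"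
  let ?D = "\<lambda>k. poly ((pderiv ^^ (2 * k)) q) x"
  have D: "?D (Suc k) = poly ((pderiv ^^ (2 * k)) (pderiv (pderiv q))) x" for k
    by (simp add: funpow_swap1)
  \<comment> \<open>The constant k = 0 term is split off, so that differentiating the others in time
    merely lowers the index by one.\<close>
  have eq: "poly (heat_poly q s) x = ?D 0 + (\<Sum>k\<le>degree q. ?c (Suc k) s * ?D (Suc k))" for s
    by (simp add: heat_poly_eq_sum[of q "Suc (degree q)"] sum.atMost_Suc_shift poly_sum
             del: sum.atMost_Suc)
  have c: "((\<lambda>t. ?c (Suc k) t) has_real_derivative ?c k t / 2) (at t)" for k
  proof -
    have "((\<lambda>t. ?c (Suc k) t) has_real_derivative
        real (Suc k) * t ^ k / (2 ^ Suc k * fact (Suc k))) (at t)"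
      using DERIV_cdivide[OF DERIV_pow[of "Suc k" t UNIV], of "2 ^ Suc k * fact (Suc k)"] by simp
    also have "real (Suc k) * t ^ k / (2 ^ Suc k * fact (Suc k)) = ?c k t / 2"
      by (simp add: divide_simps del: of_nat_Suc)
    finally show ?thesis .
  qed
  have "((\<lambda>s. ?D 0 + (\<Sum>k\<le>degree q. ?c (Suc k) s * ?D (Suc k))) has_real_derivative
          0 + (\<Sum>k\<le>degree q. ?c k t / 2 * ?D (Suc k))) (at t)"
    by (intro DERIV_add DERIV_const DERIV_sum DERIV_cmult_right c)
  also have "0 + (\<Sum>k\<le>degree q. ?c k t / 2 * ?D (Suc k)) =
      poly (heat_poly (pderiv (pderiv q)) t) x / 2"
    by (subst heat_poly_eq_sum[of _ "degree q"])
      (simp_all add: degree_pderiv funpow_swap1 poly_sum sum_divide_distrib mult.commute)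
  finally show ?thesis by (simp only: eq)
qed

text \<open>Induction on the degree: the time derivative of the difference of both sides is half the
  same difference for q'', which has lower degree and hence vanishes. At t = 0 the two sides
  agree.\<close>

lemma heat_poly_semigroup: "heat_poly (heat_poly q s) t = heat_poly q (s + t)"
proof (rule poly_eq_poly_eq_iff[THEN iffD1], rule ext)
  fix x
  show "poly (heat_poly (heat_poly q s) t) x = poly (heat_poly q (s + t)) x"
  proof (induction "degree q" arbitrary: q t rule: less_induct)
    case less
    show ?case
    proof (cases "degree q = 0")
      case True
      then obtain c where "q = [:c:]" by (rule degree_eq_zeroE)
      then show ?thesis by (simp add: heat_poly_def)
    next
      case False
      let ?f = "\<lambda>t. poly (heat_poly (heat_poly q s) t) x - poly (heat_poly q (s + t)) x"
      have IH: "poly (heat_poly (heat_poly (pderiv (pderiv q)) s) t) x =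
                poly (heat_poly (pderiv (pderiv q)) (s + t)) x" for t
        using False by (intro less) (simp add: degree_pderiv)
      have "(?f has_real_derivative 0) (at t)" for t
      proof -
        have "(?f has_real_derivative
             poly (heat_poly (pderiv (pderiv (heat_poly q s))) t) x / 2 -
             poly (heat_poly (pderiv (pderiv q)) (s + t)) x / 2) (at t)"
          by (intro DERIV_diff poly_heat_poly_has_field_derivative_time)
             (use DERIV_shift[of "\<lambda>t. poly (heat_poly q t) x" _ t s]
                poly_heat_poly_has_field_derivative_time[of q x "t + s"] in
              \<open>simp add: add.commute\<close>)
        then show ?thesis by (simp add: pderiv_heat_poly IH)
      qed
      then have "?f t = ?f 0" by (intro DERIV_isconst_all) auto
      then show ?thesis by simp
    qed
  qed
qed

text \<open>The heat flow turns multiplication by x into the operator x + t D. This yields the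
  recurrence of the heat polynomials as well as the expansion of the flow around a point.\<close>

lemma heat_poly_mult_X:
  "heat_poly (pCons 0 q) t = pCons 0 (heat_poly q t) + smult t (heat_poly (pderiv q) t)"
proof -
  \<comment> \<open>Leibniz rule for x q. For n = 0 the truncated exponent n - 1 is harmless, as its
    factor is 0.\<close>
  have D: "(pderiv ^^ n) (pCons 0 q) =
      pCons 0 ((pderiv ^^ n) q) + smult (of_nat n) ((pderiv ^^ (n - 1)) q)" for n
  proof (induction n)
    case (Suc n)
    show ?case
    proof (cases n)
      case 0
      then show ?thesis by (simp add: pderiv_pCons)
    next
      case (Suc m)
      show ?thesis
        unfolding funpow.simps o_def Suc.IH
        by (simp add: Suc pderiv_add pderiv_pCons pderiv_smult)
          (rule poly_eqI, simp add: algebra_simps)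
    qed
  qed simp
  let ?N = "Suc (degree q)"
  let ?c = "\<lambda>k. t ^ k / (2 ^ k * fact k) :: real"
  have "heat_poly (pCons 0 q) t =
     (\<Sum>k\<le>?N. smult (?c k) (pCons 0 ((pderiv ^^ (2 * k)) q))) +
     (\<Sum>k\<le>?N. smult (?c k) (smult (of_nat (2 * k)) ((pderiv ^^ (2 * k - 1)) q)))"
    by (subst heat_poly_eq_sum[of _ ?N])
      (simp_all add: degree_pCons_le D smult_add_right sum.distrib del: sum.atMost_Suc)
  also have "(\<Sum>k\<le>?N. smult (?c k) (pCons 0 ((pderiv ^^ (2 * k)) q))) =
      [:0, 1:] * (\<Sum>k\<le>?N. smult (?c k) ((pderiv ^^ (2 * k)) q))"
    by (simp add: sum_distrib_left del: sum.atMost_Suc)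
  also have "\<dots> = pCons 0 (heat_poly q t)"
    by (subst heat_poly_eq_sum[of q ?N]) (simp_all del: sum.atMost_Suc)
  also have "(\<Sum>k\<le>?N. smult (?c k) (smult (of_nat (2 * k)) ((pderiv ^^ (2 * k - 1)) q))) =
      (\<Sum>k\<le>degree q. smult (t * ?c k) ((pderiv ^^ (2 * k)) (pderiv q)))"
  proof -
    \<comment> \<open>The k = 0 term vanishes; after the shift k to k + 1, the factor 2(k + 1)
      cancels against 2^(k+1) (k+1)! and leaves t times the old coefficient.\<close>
    have "?c (Suc k) * of_nat (2 * Suc k) = t * ?c k" for k
    proof -
      have "?c (Suc k) * of_nat (2 * Suc k) =
          (2 * real (Suc k)) * (t * t ^ k) / ((2 * real (Suc k)) * (2 ^ k * fact k))"
        by (simp add: algebra_simps)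
      then show ?thesis
        by (subst (asm) mult_divide_mult_cancel_left) auto
    qed
    moreover have "(pderiv ^^ (2 * Suc k - 1)) q = (pderiv ^^ (2 * k)) (pderiv q)" for k
      by (simp add: funpow_swap1)
    ultimately show ?thesis
      unfolding sum.atMost_Suc_shift smult_smult by (simp only:) simp
  qed
  also have "\<dots> = smult t (heat_poly (pderiv q) t)"
    by (subst heat_poly_eq_sum[of _ "degree q"]) (simp_all add: degree_pderiv smult_sum_right)
  finally show ?thesis .
qed

lemma poly_heat_poly_pCons_0:
  "poly (heat_poly (pCons 0 q) t) x = x * poly (heat_poly q t) x + t * poly (heat_poly (pderiv q) t) x"
  by (simp add: heat_poly_mult_X)

lemma coeff_heat_poly:
  "coeff (heat_poly q t) n =
    (\<Sum>k\<le>degree q. t ^ k / (2 ^ k * fact k) * (pochhammer (of_nat (Suc n)) (2 * k) * coeff q (n + 2 * k)))"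
  by (simp add: heat_poly_def coeff_sum coeff_higher_pderiv)

text \<open>Derivatives only feed lower coefficients. Hence degree and leading coefficient are
  constant in time, which later gives root bounds that are uniform on bounded time
  intervals.\<close>

lemma coeff_heat_poly_ge_degree:
  assumes "degree q \<le> n"
  shows "coeff (heat_poly q t) n = coeff q n"
  unfolding coeff_heat_poly using assms
  by (subst sum.mono_neutral_right[of _ "{0}"]) (auto simp: coeff_eq_0)

lemma degree_heat_poly [simp]: "degree (heat_poly q t) = degree q"
proof (rule antisym)
  show "degree (heat_poly q t) \<le> degree q"
    by (rule degree_le) (simp add: coeff_heat_poly_ge_degree coeff_eq_0)
  show "degree q \<le> degree (heat_poly q t)"
  proof (cases "q = 0")
    case False
    then show ?thesis by (intro le_degree) (simp add: coeff_heat_poly_ge_degree)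
  qed simp
qed

lemma lead_coeff_heat_poly [simp]: "lead_coeff (heat_poly q t) = lead_coeff q"
  by (simp add: coeff_heat_poly_ge_degree)

lemma heat_poly_eq_0_iff [simp]: "heat_poly q t = 0 \<longleftrightarrow> q = 0"
  by (metis lead_coeff_heat_poly leading_coeff_0_iff)

lemma tendsto_poly_heat_poly [tendsto_intros]:
  assumes "(x \<longlongrightarrow> a) F" "(t \<longlongrightarrow> T) F"
  shows "((\<lambda>z. poly (heat_poly q (t z)) (x z)) \<longlongrightarrow> poly (heat_poly q T) a) F"
  unfolding heat_poly_def poly_sum poly_smult
  by (intro tendsto_intros assms) auto

lemma continuous_on_poly_heat_poly [continuous_intros]:
  assumes "continuous_on S x" "continuous_on S t"
  shows "continuous_on S (\<lambda>z. poly (heat_poly q (t z)) (x z))"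
  using assms unfolding continuous_on_def by (auto intro: tendsto_intros)

section \<open>Recentring, and differentiation along curves\<close>

lemma heat_poly_pcompose_shift:
  "heat_poly (pcompose q [:a, 1:]) t = pcompose (heat_poly q t) [:a, 1:]"
proof -
  have D: "(pderiv ^^ n) (pcompose q [:a, 1:]) = pcompose ((pderiv ^^ n) q) [:a, 1:]" for n
    by (induction n) (simp_all add: pderiv_pcompose pderiv_pCons)
  show ?thesis
    unfolding heat_poly_def by (simp add: D pcompose_sum pcompose_smult degree_pcompose)
qed

text \<open>Translation invariance and the semigroup law move an arbitrary point (a, T) to the
  origin, so local questions need only be studied there.\<close>

lemma heat_poly_recentre:
  "poly (heat_poly q (T + \<tau>)) (a + \<xi>) = poly (heat_poly (pcompose (heat_poly q T) [:a, 1:]) \<tau>) \<xi>"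
  by (simp add: heat_poly_pcompose_shift heat_poly_semigroup poly_pcompose)

text \<open>An exact first-order expansion: after recentring at (a, T), the constant coefficient is
  split off as \<open>pCons c g\<close> and the rule x + t D is applied to the rest. Both factors
  are continuous, so the chain rule and implicit differentiation reduce to limits.\<close>

lemma heat_poly_expansion:
  "\<exists>g. (\<forall>x t. poly (heat_poly q t) x = poly (heat_poly q T) a
       + (x - a) * poly (heat_poly g (t - T)) (x - a)
       + (t - T) * poly (heat_poly (pderiv g) (t - T)) (x - a)) \<and>
     poly g 0 = poly (heat_poly (pderiv q) T) a \<and>
     poly (pderiv g) 0 = poly (heat_poly (pderiv (pderiv q)) T) a / 2"
proof -
  obtain c g where g: "pcompose (heat_poly q T) [:a, 1:] = pCons c g"
    by (cases "pcompose (heat_poly q T) [:a, 1:]")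
  have "poly (pcompose (heat_poly q T) [:a, 1:]) 0 = c"
    by (simp only: g) simp
  then have c: "c = poly (heat_poly q T) a"
    by (simp add: poly_pcompose)
  have d1: "pcompose (heat_poly (pderiv q) T) [:a, 1:] = pderiv (pCons c g)"
    unfolding g[symmetric] by (simp add: pderiv_pcompose pderiv_pCons pderiv_heat_poly)
  have d2: "pcompose (heat_poly (pderiv (pderiv q)) T) [:a, 1:] = pderiv (pderiv (pCons c g))"
    unfolding d1[symmetric] by (simp add: pderiv_pcompose pderiv_pCons pderiv_heat_poly)
  have "pCons c g = [:c:] + pCons 0 g" by simp
  then have "poly (heat_poly (pCons c g) \<tau>) \<xi> =
      c + \<xi> * poly (heat_poly g \<tau>) \<xi> + \<tau> * poly (heat_poly (pderiv g) \<tau>) \<xi>" for \<xi> \<tau>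
    unfolding \<open>pCons c g = [:c:] + pCons 0 g\<close> heat_poly_add
    by (simp add: poly_heat_poly_pCons_0 heat_poly_def[of "[:c:]"] del: add_pCons)
  then have "poly (heat_poly q t) x = poly (heat_poly q T) a
       + (x - a) * poly (heat_poly g (t - T)) (x - a)
       + (t - T) * poly (heat_poly (pderiv g) (t - T)) (x - a)" for x t
    using heat_poly_recentre[of q T "t - T" a "x - a"] by (simp only: g c) simp
  moreover have "poly g 0 = poly (heat_poly (pderiv q) T) a"
    using arg_cong[OF d1, of "\<lambda>p. poly p 0"] by (simp add: poly_pcompose pderiv_pCons)
  moreover have "poly (pderiv g) 0 = poly (heat_poly (pderiv (pderiv q)) T) a / 2"
    using arg_cong[OF d2, of "\<lambda>p. poly p 0"] by (simp add: poly_pcompose pderiv_pCons pderiv_add)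
  ultimately show ?thesis by (intro exI[of _ g] conjI allI)
qed

text \<open>The chain rule, with the time derivative already replaced by half the second space
  derivative.\<close>

lemma DERIV_heat_poly_curve:
  assumes "(x has_real_derivative x') (at t within S)"
  shows "((\<lambda>s. poly (heat_poly q s) (x s)) has_real_derivative
     x' * poly (heat_poly (pderiv q) t) (x t) + poly (heat_poly (pderiv (pderiv q)) t) (x t) / 2)
     (at t within S)"
proof -
  obtain g where exp:
    "\<forall>y s. poly (heat_poly q s) y = poly (heat_poly q t) (x t)
       + (y - x t) * poly (heat_poly g (s - t)) (y - x t)
       + (s - t) * poly (heat_poly (pderiv g) (s - t)) (y - x t)"
    and g: "poly g 0 = poly (heat_poly (pderiv q) t) (x t)"
    "poly (pderiv g) 0 = poly (heat_poly (pderiv (pderiv q)) t) (x t) / 2"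
    using heat_poly_expansion[of q t "x t"] by (elim exE conjE) (rule that; assumption)
  have x: "((\<lambda>s. (x s - x t) / (s - t)) \<longlongrightarrow> x') (at t within S)"
    using assms by (simp add: has_field_derivative_iff)
  have "(x \<longlongrightarrow> x t) (at t within S)"
    using DERIV_continuous[OF assms] by (simp add: continuous_within)
  then have 0: "((\<lambda>s. x s - x t) \<longlongrightarrow> 0) (at t within S)" by (simp add: LIM_zero)
  have 1: "((\<lambda>s. s - t) \<longlongrightarrow> 0) (at t within S)" by (intro tendsto_eq_intros) auto
  have "((\<lambda>s. (x s - x t) / (s - t) * poly (heat_poly g (s - t)) (x s - x t)
        + poly (heat_poly (pderiv g) (s - t)) (x s - x t)) \<longlongrightarrow>
        x' * poly (heat_poly g 0) 0 + poly (heat_poly (pderiv g) 0) 0) (at t within S)"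
    by (intro tendsto_intros x 0 1)
  moreover have "\<forall>\<^sub>F s in at t within S.
     (x s - x t) / (s - t) * poly (heat_poly g (s - t)) (x s - x t)
        + poly (heat_poly (pderiv g) (s - t)) (x s - x t) =
     (poly (heat_poly q s) (x s) - poly (heat_poly q t) (x t)) / (s - t)"
    unfolding eventually_at_filter
  proof (intro always_eventually allI impI)
    fix s assume "s \<noteq> t"
    with exp[rule_format, of s "x s"]
    show "(x s - x t) / (s - t) * poly (heat_poly g (s - t)) (x s - x t)
        + poly (heat_poly (pderiv g) (s - t)) (x s - x t) =
     (poly (heat_poly q s) (x s) - poly (heat_poly q t) (x t)) / (s - t)"
      by (simp add: field_simps)
  qed
  ultimately show ?thesis
    by (simp add: has_field_derivative_iff g tendsto_cong)
qed

text \<open>Implicit differentiation of a curve that is only known to be continuous: along zeros the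
  expansion reads (x s - x t) A + (s - t) B = 0, so the difference quotient is -B/A, where A tends
  to a nonzero value. With q = p' the result is the Yuille-Poggio equation.\<close>

lemma DERIV_heat_poly_zero_curve:
  assumes cont: "(x \<longlongrightarrow> x t) (at t within S)" and t: "t \<in> S"
    and zero: "\<And>s. s \<in> S \<Longrightarrow> poly (heat_poly q s) (x s) = 0"
    and nz: "poly (heat_poly (pderiv q) t) (x t) \<noteq> 0"
  shows "(x has_real_derivative
     - poly (heat_poly (pderiv (pderiv q)) t) (x t) / (2 * poly (heat_poly (pderiv q) t) (x t)))
     (at t within S)"
proof -
  obtain g where exp:
    "\<forall>y s. poly (heat_poly q s) y = poly (heat_poly q t) (x t)
       + (y - x t) * poly (heat_poly g (s - t)) (y - x t)
       + (s - t) * poly (heat_poly (pderiv g) (s - t)) (y - x t)"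
    and g: "poly g 0 = poly (heat_poly (pderiv q) t) (x t)"
    "poly (pderiv g) 0 = poly (heat_poly (pderiv (pderiv q)) t) (x t) / 2"
    using heat_poly_expansion[of q t "x t"] by (elim exE conjE) (rule that; assumption)
  let ?A = "\<lambda>s. poly (heat_poly g (s - t)) (x s - x t)"
  let ?B = "\<lambda>s. poly (heat_poly (pderiv g) (s - t)) (x s - x t)"
  have 0: "((\<lambda>s. x s - x t) \<longlongrightarrow> 0) (at t within S)" using cont by (simp add: LIM_zero)
  have 1: "((\<lambda>s. s - t) \<longlongrightarrow> 0) (at t within S)" by (intro tendsto_eq_intros) auto
  have A: "(?A \<longlongrightarrow> poly (heat_poly g 0) 0) (at t within S)"
    and B: "(?B \<longlongrightarrow> poly (heat_poly (pderiv g) 0) 0) (at t within S)"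
    by (intro tendsto_intros 0 1)+
  have nz': "poly (heat_poly g 0) 0 \<noteq> 0" using nz by (simp add: g)
  have "((\<lambda>s. - ?B s / ?A s) \<longlongrightarrow> - poly (heat_poly (pderiv g) 0) 0 / poly (heat_poly g 0) 0) (at t within S)"
    by (intro tendsto_intros A B nz')
  moreover have "\<forall>\<^sub>F s in at t within S. - ?B s / ?A s = (x s - x t) / (s - t)"
  proof -
    have "\<forall>\<^sub>F s in at t within S. ?A s \<noteq> 0" by (rule tendsto_imp_eventually_ne[OF A nz'])
    moreover have "\<forall>\<^sub>F s in at t within S. s \<in> S \<and> s \<noteq> t" by (simp add: eventually_at_filter)
    ultimately show ?thesis
    proof eventually_elim
      case (elim s)
      have "(x s - x t) * ?A s + (s - t) * ?B s = 0"
        using exp[rule_format, of s "x s"] zero[OF t] zero[of s] elim by simp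
      with elim show ?case by (simp add: field_simps)
    qed
  qed
  ultimately show ?thesis
    by (simp add: has_field_derivative_iff g tendsto_cong)
qed

section \<open>Heat polynomials and parabolic blow-up\<close>

text \<open>The heat polynomials, i.e. the solutions with initial value x^n; they are homogeneous of
  degree n when x has weight 1 and t has weight 2.\<close>

definition heat_monom :: "nat \<Rightarrow> real \<Rightarrow> real \<Rightarrow> real" where
  "heat_monom n t x = poly (heat_poly (monom 1 n) t) x"

lemma heat_monom_0 [simp]: "heat_monom 0 t x = 1"
  by (simp add: heat_monom_def heat_poly_def)

lemma heat_monom_1 [simp]: "heat_monom (Suc 0) t x = x"
  by (simp add: heat_monom_def monom_Suc heat_poly_mult_X pderiv_monom heat_poly_def[of 1])

lemma heat_monom_Suc_Suc:
  "heat_monom (Suc (Suc n)) t x = x * heat_monom (Suc n) t x + t * (real (Suc n) * heat_monom n t x)"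
proof -
  have "monom (real (Suc n)) n = smult (real (Suc n)) (monom 1 n)" by (simp add: smult_monom)
  then show ?thesis
    unfolding heat_monom_def monom_Suc[of _ "Suc n"] poly_heat_poly_pCons_0
    by (simp add: pderiv_monom heat_poly_smult del: of_nat_Suc)
qed

lemma heat_monom_scale: "heat_monom n (c\<^sup>2 * t) (c * x) = c ^ n * heat_monom n t x"
proof -
  have "heat_monom n (c\<^sup>2 * t) (c * x) = c ^ n * heat_monom n t x \<and>
    heat_monom (Suc n) (c\<^sup>2 * t) (c * x) = c ^ Suc n * heat_monom (Suc n) t x"
    by (induction n) (auto simp: heat_monom_Suc_Suc power2_eq_square algebra_simps)
  then show ?thesis ..
qed

lemma heat_monom_time_0: "heat_monom n 0 x = x ^ n"
  by (simp add: heat_monom_def poly_monom)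

lemma DERIV_heat_monom:
  "(heat_monom (Suc n) t has_real_derivative real (Suc n) * heat_monom n t x) (at x)"
proof -
  have "monom (real (Suc n)) n = smult (real (Suc n)) (monom 1 n)" by (simp add: smult_monom)
  then have "pderiv (heat_poly (monom 1 (Suc n)) t) = smult (real (Suc n)) (heat_poly (monom 1 n) t)"
    by (simp add: pderiv_heat_poly pderiv_monom flip: heat_poly_smult)
  then show ?thesis
    using poly_DERIV[of "heat_poly (monom 1 (Suc n)) t" x]
    by (simp add: heat_monom_def[abs_def])
qed

lemma tendsto_heat_monom [tendsto_intros]:
  assumes "(x \<longlongrightarrow> a) F" "(t \<longlongrightarrow> T) F"
  shows "((\<lambda>z. heat_monom n (t z) (x z)) \<longlongrightarrow> heat_monom n T a) F"
  unfolding heat_monom_def by (intro tendsto_intros assms)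

text \<open>For nonzero t the recurrence passes a common zero of two consecutive polynomials down to
  the constant 1, which is impossible; at t = 0 they are powers of x.\<close>

lemma heat_monom_no_common_zero:
  assumes "heat_monom (Suc n) t x = 0" "heat_monom n t x = 0"
  shows "x = 0 \<and> t = 0"
  using assms
proof (induction n)
  case (Suc n)
  from Suc.prems have "t * (real (Suc n) * heat_monom n t x) = 0"
    by (simp add: heat_monom_Suc_Suc del: of_nat_Suc)
  then consider "t = 0" | "heat_monom n t x = 0" by auto
  then show ?case
  proof cases
    case 1
    with Suc.prems show ?thesis by (auto simp: heat_monom_time_0)
  next
    case 2
    with Suc show ?thesis by blast
  qed
qed simp

text \<open>At time \<open>-1\<close> the heat polynomials are the (probabilists') Hermite polynomials.\<close>

lemma hermite_largest_zero:
  "\<exists>y\<ge>0. (n > 0 \<longrightarrow> y > 0) \<and> heat_monom (Suc n) (-1) y = 0 \<and> heat_monom n (-1) y > 0 \<and>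
     (\<forall>x>y. heat_monom (Suc n) (-1) x > 0)"
proof (induction n)
  case 0
  show ?case by (intro exI[of _ 0]) auto
next
  case (Suc n)
  then obtain y where y: "y \<ge> 0" "heat_monom (Suc n) (-1) y = 0" "heat_monom n (-1) y > 0"
    "\<And>x. x > y \<Longrightarrow> heat_monom (Suc n) (-1) x > 0" by blast
  define h where "h = heat_poly (monom 1 (Suc (Suc n))) (-1)"
  have h: "heat_monom (Suc (Suc n)) (-1) x = poly h x" for x by (simp add: heat_monom_def h_def)
  \<comment> \<open>At a zero of the previous polynomial the recurrence leaves only minus a positive
    multiple of the one before it. Being monic, the new polynomial must therefore vanish again
    further to the right.\<close>
  have neg: "poly h y < 0"
    using y by (simp flip: h add: heat_monom_Suc_Suc zero_less_mult_iff del: of_nat_Suc)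
  have lc: "lead_coeff h = 1" unfolding h_def lead_coeff_heat_poly by (simp add: degree_monom_eq)
  then obtain N where N: "\<And>x. x \<ge> N \<Longrightarrow> poly h x \<ge> 1"
    using poly_pinfty_gt_lc[of h] by auto
  define Z where "Z = {x. x \<ge> y \<and> poly h x = 0}"
  have "h \<noteq> 0" using lc by auto
  then have "finite Z" unfolding Z_def
    by (intro finite_subset[OF _ poly_roots_finite[of h]]) auto
  have zero: "\<exists>z>x. poly h z = 0" if "poly h x < 0" for x
    using poly_IVT_pos[of x "max N x + 1" h] N[of "max N x + 1"] that by fastforce
  then have "Z \<noteq> {}" using zero[OF neg] by (auto simp: Z_def intro: less_imp_le)
  define y' where "y' = Max Z"
  have "y' \<in> Z" unfolding y'_def using \<open>finite Z\<close> \<open>Z \<noteq> {}\<close> by (rule Max_in)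
  have y'_max: "z \<le> y'" if "z \<in> Z" for z unfolding y'_def using \<open>finite Z\<close> that by simp
  have "y' > y" using \<open>y' \<in> Z\<close> neg by (auto simp: Z_def order.order_iff_strict)
  moreover have "poly h x > 0" if "x > y'" for x
  proof (rule ccontr)
    assume "\<not> poly h x > 0"
    then obtain z where "z \<ge> x" "poly h z = 0"
      using zero[of x] by (metis less_eq_real_def linorder_not_less)
    then show False using y'_max[of z] that \<open>y' > y\<close> by (simp add: Z_def)
  qed
  ultimately show ?case
    using y \<open>y' \<in> Z\<close> by (intro exI[of _ y']) (auto simp: h Z_def)
qed

text \<open>The largest zero is simple, since the derivative there is a positive multiple of the
  preceding polynomial, so the sign changes across it. For n at least 2 it is positive; keeping
  \<open>a\<close> positive makes the mirrored interval disjoint from this one.\<close>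

lemma hermite_sign_change:
  assumes "n \<ge> 2"
  obtains a b where "0 < a" "a < b" "heat_monom n (-1) a * heat_monom n (-1) b < 0"
proof -
  obtain k where k: "n = Suc k" "k > 0" using assms by (cases n) auto
  obtain y where y: "y > 0" "heat_monom n (-1) y = 0" "heat_monom k (-1) y > 0"
    "heat_monom n (-1) (y + 1) > 0"
    using hermite_largest_zero[of k] k by auto
  have "(heat_monom n (-1) has_real_derivative real (Suc k) * heat_monom k (-1) y) (at y)"
    using DERIV_heat_monom k by blast
  from DERIV_pos_inc_left[OF this] y obtain d where
    d: "d > 0" "\<And>h. 0 < h \<Longrightarrow> h < d \<Longrightarrow> heat_monom n (-1) (y - h) < 0" by auto
  have "heat_monom n (-1) (y - min (d / 2) (y / 2)) < 0" using d y by (intro d) auto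
  with y d show ?thesis
    by (intro that[of "y - min (d / 2) (y / 2)" "y + 1"]) (auto simp: mult_neg_pos)
qed

text \<open>The parabolic rescaling of the heat flow of \<open>g\<close>, divided by \<open>\<sigma> ^ m\<close>; the truncated
  exponent is harmless once \<open>g\<close> vanishes to order \<open>m\<close>.\<close>

definition blowup :: "real poly \<Rightarrow> nat \<Rightarrow> real \<Rightarrow> real \<Rightarrow> real \<Rightarrow> real" where
  "blowup g m \<sigma> t x = (\<Sum>k\<le>degree g. coeff g k * \<sigma> ^ (k - m) * heat_monom k t x)"

lemma poly_heat_poly_eq_sum_heat_monom:
  "poly (heat_poly g t) x = (\<Sum>k\<le>degree g. coeff g k * heat_monom k t x)"
proof -
  have "poly (heat_poly g t) x = poly (heat_poly (\<Sum>k\<le>degree g. smult (coeff g k) (monom 1 k)) t) x"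
    by (simp add: smult_monom poly_as_sum_of_monoms)
  then show ?thesis
    by (simp add: heat_poly_sum heat_poly_smult poly_sum heat_monom_def)
qed

text \<open>Parabolic homogeneity pulls \<sigma>^k out of the k-th term, and only terms with k at
  least m are present.\<close>

lemma poly_heat_poly_eq_blowup:
  assumes "\<And>k. k < m \<Longrightarrow> coeff g k = 0"
  shows "poly (heat_poly g (\<sigma>\<^sup>2 * t)) (\<sigma> * x) = \<sigma> ^ m * blowup g m \<sigma> t x"
proof -
  have "coeff g k * \<sigma> ^ k = \<sigma> ^ m * (coeff g k * \<sigma> ^ (k - m))" for k
    using assms[of k] by (cases "k < m") (simp_all flip: power_add)
  then have "coeff g k * (\<sigma> ^ k * h) = \<sigma> ^ m * (coeff g k * \<sigma> ^ (k - m) * h)" for k h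
    by (metis mult.assoc)
  then show ?thesis
    unfolding poly_heat_poly_eq_sum_heat_monom blowup_def heat_monom_scale sum_distrib_left
    by (intro sum.cong refl)
qed

text \<open>The blow-up limit: for k > m the power of 0 vanishes, for k < m the coefficient does.
  Continuity in \<sigma> then transfers information from the heat polynomial to small
  scales.\<close>

lemma blowup_at_0:
  assumes "\<And>k. k < m \<Longrightarrow> coeff g k = 0"
  shows "blowup g m 0 t x = coeff g m * heat_monom m t x"
proof (cases "m \<le> degree g")
  case True
  have "blowup g m 0 t x = (\<Sum>k\<in>{m}. coeff g k * 0 ^ (k - m) * heat_monom k t x)"
    unfolding blowup_def using True assms
    by (intro sum.mono_neutral_right) (auto simp: power_0_left not_le)
  then show ?thesis by simp
next
  case False
  then show ?thesis
    unfolding blowup_def using assms by (auto simp: coeff_eq_0 intro!: sum.neutral)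
qed

lemma tendsto_blowup [tendsto_intros]:
  assumes "(s \<longlongrightarrow> \<sigma>) F" "(t \<longlongrightarrow> T) F" "(x \<longlongrightarrow> a) F"
  shows "((\<lambda>z. blowup g m (s z) (t z) (x z)) \<longlongrightarrow> blowup g m \<sigma> T a) F"
  unfolding blowup_def by (intro tendsto_intros assms)

lemma continuous_on_blowup [continuous_intros]:
  assumes "continuous_on S s" "continuous_on S t" "continuous_on S x"
  shows "continuous_on S (\<lambda>z. blowup g m (s z) (t z) (x z))"
  using assms unfolding continuous_on_def by (auto intro: tendsto_intros)

lemma lowest_coeff:
  assumes "g \<noteq> 0"
  obtains m where "coeff g m \<noteq> 0" "\<And>k. k < m \<Longrightarrow> coeff g k = 0"
proof -
  have "\<exists>m. coeff g m \<noteq> 0" using assms by (metis leading_coeff_0_iff)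
  then have "coeff g (LEAST m. coeff g m \<noteq> 0) \<noteq> 0" by (rule LeastI_ex)
  then show ?thesis by (rule that) (use not_less_Least in blast)
qed

text \<open>Compactness on the rescaled unit sphere: a singular point at parabolic distance \<sigma>
  rescales to a common zero of the blow-ups of g and g'. At \<sigma> = 0 these are nonzero multiples
  of two consecutive heat polynomials, without common zero on the sphere, so \<sigma> is bounded
  away from 0.\<close>

lemma singular_origin_isolated:
  assumes "g \<noteq> 0"
  shows "\<exists>r>0. \<forall>x t. \<bar>x\<bar> < r \<longrightarrow> sqrt \<bar>t\<bar> < r \<longrightarrow> poly (heat_poly g t) x = 0 \<longrightarrow>
       poly (heat_poly (pderiv g) t) x = 0 \<longrightarrow> x = 0 \<and> t = 0"
proof -
  obtain m where m: "coeff g m \<noteq> 0" "\<And>k. k < m \<Longrightarrow> coeff g k = 0"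
    using lowest_coeff[OF assms] by blast
  have m': "coeff (pderiv g) k = 0" if "k < m - 1" for k
    using m(2)[of "Suc k"] that by (simp add: coeff_pderiv)
  \<comment> \<open>All common zeros of the two blow-ups with a rescaled position satisfying |x| = 1
    or |t| = 1, over all scales in [0, 1], including the limit scale 0.\<close>
  define D where "D = ({0..1} \<times> {-1..1} \<times> {-1..1}) \<inter>
    {z. (\<bar>snd (snd z)\<bar> = 1 \<or> \<bar>fst (snd z)\<bar> = 1) \<and>
      blowup g m (fst z) (fst (snd z)) (snd (snd z)) = 0 \<and>
      blowup (pderiv g) (m - 1) (fst z) (fst (snd z)) (snd (snd z)) = 0}"
  have "compact D"
    unfolding D_def
    by (intro compact_Int_closed compact_Times compact_Icc closed_Collect_conj closed_Collect_disj
        closed_Collect_eq continuous_intros)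
  have pos: "fst z > 0" if "z \<in> D" for z
  proof (rule ccontr)
    obtain \<sigma> t x where z: "z = (\<sigma>, t, x)" by (cases z)
    assume "\<not> fst z > 0"
    with that z have "\<sigma> = 0" and xt: "\<bar>x\<bar> = 1 \<or> \<bar>t\<bar> = 1" and
      0: "blowup g m 0 t x = 0" "blowup (pderiv g) (m - 1) 0 t x = 0"
      by (auto simp: D_def)
    from 0(1) have hm: "heat_monom m t x = 0" using m by (simp add: blowup_at_0)
    \<comment> \<open>m = 0 is excluded because the heat polynomial of index 0 is the constant 1;
      hence m - 1 is an honest predecessor.\<close>
    then obtain n where n: "m = Suc n" by (cases m) auto
    then have "coeff (pderiv g) n * heat_monom n t x = 0"
      using 0(2) blowup_at_0[of "m - 1" "pderiv g" t x] m' by simp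
    then have "heat_monom n t x = 0" using m(1) by (simp add: n coeff_pderiv)
    with hm n heat_monom_no_common_zero[of n t x] xt show False by auto
  qed
  obtain r where r: "r > 0" "r \<le> 1" "\<And>z. z \<in> D \<Longrightarrow> r \<le> fst z"
  proof (cases "D = {}")
    case True
    then show ?thesis using that[of 1] by auto
  next
    case False
    have "continuous_on D fst" by (intro continuous_intros)
    from continuous_attains_inf[OF \<open>compact D\<close> False this]
    obtain z where "z \<in> D" "\<forall>w\<in>D. fst z \<le> fst w" by blast
    then show ?thesis using pos[of z] that[of "min 1 (fst z)"] by (simp add: min_le_iff_disj)
  qed
  show ?thesis
  proof (intro exI[of _ r] conjI[OF r(1)] allI impI)
    fix x t
    assume small: "\<bar>x\<bar> < r" "sqrt \<bar>t\<bar> < r"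
      and zero: "poly (heat_poly g t) x = 0" "poly (heat_poly (pderiv g) t) x = 0"
    show "x = 0 \<and> t = 0"
    proof (rule ccontr)
      assume nz: "\<not> (x = 0 \<and> t = 0)"
      \<comment> \<open>The parabolic distance to the origin, chosen so that rescaling by it lands
        on the sphere used in \<open>D\<close>.\<close>
      define \<sigma> where "\<sigma> = max \<bar>x\<bar> (sqrt \<bar>t\<bar>)"
      have \<sigma>: "\<sigma> > 0" "\<sigma> < r" using nz small by (auto simp: \<sigma>_def less_max_iff_disj)
      have "\<bar>t\<bar> = (sqrt \<bar>t\<bar>)\<^sup>2" by simp
      also have "\<dots> \<le> \<sigma>\<^sup>2" unfolding \<sigma>_def by (intro power_mono) auto
      finally have t: "\<bar>t\<bar> \<le> \<sigma>\<^sup>2" .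
      have x: "\<bar>x\<bar> \<le> \<sigma>" by (simp add: \<sigma>_def)
      have eq: "\<bar>x\<bar> = \<sigma> \<or> \<bar>t\<bar> = \<sigma>\<^sup>2" by (auto simp: \<sigma>_def max_def)
      have resc: "x = \<sigma> * (x / \<sigma>)" "t = \<sigma>\<^sup>2 * (t / \<sigma>\<^sup>2)" using \<sigma> by auto
      have "blowup g m \<sigma> (t / \<sigma>\<^sup>2) (x / \<sigma>) = 0"
        using zero(1) poly_heat_poly_eq_blowup[of m g \<sigma> "t / \<sigma>\<^sup>2" "x / \<sigma>"] m \<sigma>
        by (simp flip: resc)
      moreover have "blowup (pderiv g) (m - 1) \<sigma> (t / \<sigma>\<^sup>2) (x / \<sigma>) = 0"
        using zero(2) poly_heat_poly_eq_blowup[of "m - 1" "pderiv g" \<sigma> "t / \<sigma>\<^sup>2" "x / \<sigma>"] m' \<sigma>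
        by (simp flip: resc)
      ultimately have "(\<sigma>, t / \<sigma>\<^sup>2, x / \<sigma>) \<in> D"
        using \<sigma> r t x eq by (auto simp: D_def abs_le_iff field_simps)
      then show False using r(3) \<sigma> by force
    qed
  qed
qed

section \<open>Singular points: isolation, and splitting backward in time\<close>

text \<open>For q = p' these are the points where a critical point of p(.,t) is degenerate, that is,
  where the trajectory equation breaks down on the zero set. Pairs are ordered as (x, t), as in
  \<open>yp_curve\<close>.\<close>

definition singular_points :: "real poly \<Rightarrow> (real \<times> real) set" where
  "singular_points q = {(x, t). poly (heat_poly q t) x = 0 \<and> poly (heat_poly (pderiv q) t) x = 0}"

lemma not_islimpt_singular_points:
  assumes "q \<noteq> 0"
  shows "\<not> (a, T) islimpt singular_points q"
proof
  define g where "g = pcompose (heat_poly q T) [:a, 1:]"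
  have g: "poly (heat_poly q t) x = poly (heat_poly g (t - T)) (x - a)" for x t
    using heat_poly_recentre[of q T "t - T" a "x - a"] by (simp add: g_def)
  have "pderiv g = pcompose (heat_poly (pderiv q) T) [:a, 1:]"
    by (simp add: g_def pderiv_pcompose pderiv_pCons pderiv_heat_poly)
  then have g': "poly (heat_poly (pderiv q) t) x = poly (heat_poly (pderiv g) (t - T)) (x - a)" for x t
    using heat_poly_recentre[of "pderiv q" T "t - T" a "x - a"] by simp
  have "g \<noteq> 0" using assms pcompose_eq_0[of "heat_poly q T" "[:a, 1:]"] by (auto simp: g_def)
  then have "\<exists>r>0. \<forall>x t. \<bar>x\<bar> < r \<longrightarrow> sqrt \<bar>t\<bar> < r \<longrightarrow> poly (heat_poly g t) x = 0 \<longrightarrow>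
       poly (heat_poly (pderiv g) t) x = 0 \<longrightarrow> x = 0 \<and> t = 0"
    by (rule singular_origin_isolated)
  then obtain r where r: "r > 0"
    "\<forall>x t. \<bar>x\<bar> < r \<longrightarrow> sqrt \<bar>t\<bar> < r \<longrightarrow> poly (heat_poly g t) x = 0 \<longrightarrow>
       poly (heat_poly (pderiv g) t) x = 0 \<longrightarrow> x = 0 \<and> t = 0"
    by (elim exE conjE) (rule that; assumption)
  assume "(a, T) islimpt singular_points q"
  \<comment> \<open>Times are compared through a square root, so the time component must be within
    r^2.\<close>
  then obtain z where z: "z \<in> singular_points q" "z \<noteq> (a, T)" "dist z (a, T) < min r (r\<^sup>2)"
    unfolding islimpt_approachable using r(1)
    by (metis min_less_iff_conj zero_less_power)
  obtain x t where xt: "z = (x, t)" by (cases z)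
  have "\<bar>x - a\<bar> < r" "\<bar>t - T\<bar> < r\<^sup>2"
    using z(3) dist_fst_le[of z "(a, T)"] dist_snd_le[of z "(a, T)"] by (auto simp: xt dist_real_def)
  moreover from this(2) have "sqrt \<bar>t - T\<bar> < r" using r(1) by (simp add: real_sqrt_less_iff real_less_lsqrt)
  ultimately have "x - a = 0 \<and> t - T = 0"
    using z(1) by (intro r(2)[rule_format]) (auto simp: xt singular_points_def g g')
  with z(2) show False by (simp add: xt)
qed

text \<open>Cauchy's root bound: the leading coefficient is independent of time, and the others are
  continuous, hence bounded on the compact time interval.\<close>

lemma heat_poly_roots_bounded:
  assumes "q \<noteq> 0"
  obtains R where "\<And>t x. t \<in> {A..B} \<Longrightarrow> poly (heat_poly q t) x = 0 \<Longrightarrow> \<bar>x\<bar> \<le> R"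
proof -
  let ?n = "degree q" and ?c = "lead_coeff q"
  have "\<exists>M. \<forall>t\<in>{A..B}. \<bar>coeff (heat_poly q t) i\<bar> \<le> M" for i
  proof -
    have "continuous_on {A..B} (\<lambda>t. coeff (heat_poly q t) i)"
      unfolding coeff_heat_poly by (intro continuous_intros) auto
    then have "bounded ((\<lambda>t. coeff (heat_poly q t) i) ` {A..B})"
      by (intro compact_imp_bounded compact_continuous_image compact_Icc)
    then show ?thesis by (auto simp: bounded_iff)
  qed
  then obtain M where M: "\<And>i t. t \<in> {A..B} \<Longrightarrow> \<bar>coeff (heat_poly q t) i\<bar> \<le> M i" by metis
  show ?thesis
  proof (rule that[of "max 1 ((\<Sum>i<?n. M i) / \<bar>?c\<bar>)"])
    fix t x assume t: "t \<in> {A..B}" and zero: "poly (heat_poly q t) x = 0"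
    show "\<bar>x\<bar> \<le> max 1 ((\<Sum>i<?n. M i) / \<bar>?c\<bar>)"
    proof (cases "\<bar>x\<bar> \<le> 1")
      case False
      have "poly (heat_poly q t) x = (\<Sum>i<?n. coeff (heat_poly q t) i * x ^ i) + ?c * x ^ ?n"
        unfolding poly_altdef degree_heat_poly
        by (simp add: lessThan_Suc_atMost[symmetric] coeff_heat_poly_ge_degree)
      then have *: "\<bar>?c\<bar> * \<bar>x\<bar> ^ ?n = \<bar>\<Sum>i<?n. coeff (heat_poly q t) i * x ^ i\<bar>"
        using zero by (simp flip: abs_mult power_abs)
      have "?n \<noteq> 0"
      proof
        assume "?n = 0"
        with * have "?c = 0" by simp
        with assms show False by simp
      qed
      then obtain k where k: "?n = Suc k" by (cases ?n) auto
      have "\<bar>\<Sum>i<?n. coeff (heat_poly q t) i * x ^ i\<bar> \<le> (\<Sum>i<?n. M i * \<bar>x\<bar> ^ k)"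
      proof (rule order_trans[OF sum_abs], rule sum_mono)
        fix i assume "i \<in> {..<?n}"
        then have "\<bar>x\<bar> ^ i \<le> \<bar>x\<bar> ^ k" using False k by (intro power_increasing) auto
        with M[OF t, of i] show "\<bar>coeff (heat_poly q t) i * x ^ i\<bar> \<le> M i * \<bar>x\<bar> ^ k"
          unfolding abs_mult power_abs by (intro mult_mono) auto
      qed
      then have "(\<bar>?c\<bar> * \<bar>x\<bar>) * \<bar>x\<bar> ^ k \<le> (\<Sum>i<?n. M i) * \<bar>x\<bar> ^ k"
        unfolding *[symmetric] by (simp add: k sum_distrib_right mult.assoc del: sum.lessThan_Suc)
      then have "\<bar>?c\<bar> * \<bar>x\<bar> \<le> (\<Sum>i<?n. M i)" using False by (simp add: mult_le_cancel_right)
      then show ?thesis using assms by (simp add: field_simps le_max_iff_disj)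
    qed simp
  qed
qed

text \<open>The root bound confines the singular points of a bounded time interval to a compact
  rectangle, where a set without limit points is finite.\<close>

lemma finite_singular_times:
  assumes "q \<noteq> 0"
  shows "finite (snd ` singular_points q \<inter> {A..B})"
proof -
  obtain R where R: "\<And>t x. t \<in> {A..B} \<Longrightarrow> poly (heat_poly q t) x = 0 \<Longrightarrow> \<bar>x\<bar> \<le> R"
    using heat_poly_roots_bounded[OF assms] by blast
  have "finite (({-R..R} \<times> {A..B}) \<inter> singular_points q)"
    by (intro finite_not_islimpt_in_compact compact_Times compact_Icc)
      (use not_islimpt_singular_points[OF assms] in auto)
  then have "finite (snd ` (({-R..R} \<times> {A..B}) \<inter> singular_points q))" by (rule finite_imageI)
  then show ?thesis
  proof (rule finite_subset[rotated], intro subsetI)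
    fix t assume "t \<in> snd ` singular_points q \<inter> {A..B}"
    then obtain x where "t \<in> {A..B}" "(x, t) \<in> singular_points q" by auto
    moreover from this have "\<bar>x\<bar> \<le> R" by (intro R[of t]) (auto simp: singular_points_def)
    ultimately show "t \<in> snd ` (({-R..R} \<times> {A..B}) \<inter> singular_points q)"
      by (intro image_eqI[of _ _ "(x, t)"]) (auto simp: abs_le_iff)
  qed
qed

text \<open>Backward in time the blow-up limit is a Hermite polynomial of degree at least two, whose
  largest and smallest zeros are simple and distinct.\<close>

lemma multiple_zero_splits_origin:
  assumes "g \<noteq> 0" "coeff g 0 = 0" "coeff g 1 = 0" "e > 0"
  shows "\<exists>d>0. \<forall>t. -d < t \<and> t < 0 \<longrightarrow>
    (\<exists>x y. -e < x \<and> x < 0 \<and> 0 < y \<and> y < e \<and> poly (heat_poly g t) x = 0 \<and> poly (heat_poly g t) y = 0)"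
proof -
  obtain m where m: "coeff g m \<noteq> 0" "\<And>k. k < m \<Longrightarrow> coeff g k = 0"
    using lowest_coeff[OF assms(1)] by blast
  have "m \<noteq> 0" "m \<noteq> 1" using assms m(1) by metis+
  then have "m \<ge> 2" by simp
  then obtain a b where ab: "0 < a" "a < b" "heat_monom m (-1) a * heat_monom m (-1) b < 0"
    by (rule hermite_sign_change)
  have parity: "heat_monom m (-1) (-x) = (-1) ^ m * heat_monom m (-1) x" for x
    using heat_monom_scale[of m "-1" "-1" x] by simp
  \<comment> \<open>The sign s = -1 treats the mirrored interval: parity multiplies both values by
    (-1)^m, which leaves the sign of their product unchanged.\<close>
  have ev: "\<forall>\<^sub>F \<sigma> in at_right 0. blowup g m \<sigma> (-1) (s * a) * blowup g m \<sigma> (-1) (s * b) < 0"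
    if "s = 1 \<or> s = -1" for s
  proof -
    have lim: "((\<lambda>\<sigma>. blowup g m \<sigma> (-1) (s * a) * blowup g m \<sigma> (-1) (s * b)) \<longlongrightarrow>
       blowup g m 0 (-1) (s * a) * blowup g m 0 (-1) (s * b)) (at_right 0)"
      by (intro tendsto_intros)
    have "blowup g m 0 (-1) (s * a) * blowup g m 0 (-1) (s * b) =
        (coeff g m)\<^sup>2 * (heat_monom m (-1) a * heat_monom m (-1) b)"
      using that m(2) by (auto simp: blowup_at_0 parity power2_eq_square simp flip: power_mult_distrib)
    also have "\<dots> < 0" using ab(3) m(1) by (simp add: mult_pos_neg)
    finally show ?thesis by (rule order_tendstoD(2)[OF lim])
  qed
  \<comment> \<open>Ensures that the zeros found, of absolute value below \<sigma> b, stay within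
    \<open>e\<close> of the origin.\<close>
  have small: "\<forall>\<^sub>F \<sigma> in at_right 0. \<sigma> < e / b"
    using ab assms(4) by (intro order_tendstoD(2)[OF tendsto_ident_at]) auto
  from eventually_conj[OF eventually_conj[OF ev[of 1] ev[of "-1"]] small]
  obtain \<sigma>0 where \<sigma>0: "\<sigma>0 > 0" "\<And>\<sigma>. 0 < \<sigma> \<Longrightarrow> \<sigma> < \<sigma>0 \<Longrightarrow>
      blowup g m \<sigma> (-1) a * blowup g m \<sigma> (-1) b < 0 \<and>
      blowup g m \<sigma> (-1) (-a) * blowup g m \<sigma> (-1) (-b) < 0 \<and> \<sigma> < e / b"
    unfolding eventually_at_right_field by auto
  show ?thesis
  proof (rule exI[of _ "\<sigma>0\<^sup>2"], intro conjI allI impI)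
    show "\<sigma>0\<^sup>2 > 0" using \<sigma>0(1) by simp
    fix t :: real assume t: "- \<sigma>0\<^sup>2 < t \<and> t < 0"
    \<comment> \<open>The scale at which time t becomes -1.\<close>
    define \<sigma> where "\<sigma> = sqrt (- t)"
    have "\<sigma> < \<sigma>0" unfolding \<sigma>_def using t \<sigma>0(1) by (intro real_less_lsqrt) auto
    moreover have "\<sigma> > 0" using t by (simp add: \<sigma>_def)
    ultimately have \<sigma>: "\<sigma> > 0" "blowup g m \<sigma> (-1) a * blowup g m \<sigma> (-1) b < 0"
      "blowup g m \<sigma> (-1) (-a) * blowup g m \<sigma> (-1) (-b) < 0" "\<sigma> * b < e"
      using \<sigma>0(2)[of \<sigma>] ab by (auto simp: field_simps)
    have "\<sigma>\<^sup>2 * (-1) = t" using t by (simp add: \<sigma>_def)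
    then have eq: "poly (heat_poly g t) (\<sigma> * x) = \<sigma> ^ m * blowup g m \<sigma> (-1) x" for x
      using poly_heat_poly_eq_blowup[of m g \<sigma> "-1" x] m(2) by metis
    have sgn: "poly (heat_poly g t) (\<sigma> * x) * poly (heat_poly g t) (\<sigma> * y) < 0"
      if "blowup g m \<sigma> (-1) x * blowup g m \<sigma> (-1) y < 0" for x y
    proof -
      have "poly (heat_poly g t) (\<sigma> * x) * poly (heat_poly g t) (\<sigma> * y) =
          (\<sigma> ^ m)\<^sup>2 * (blowup g m \<sigma> (-1) x * blowup g m \<sigma> (-1) y)"
        by (simp add: eq power2_eq_square)
      then show ?thesis using that \<sigma>(1) by (simp add: mult_pos_neg)
    qed
    have ord: "\<sigma> * a < \<sigma> * b" "\<sigma> * (-b) < \<sigma> * (-a)" "\<sigma> * a > 0" using \<sigma> ab by simp_all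
    obtain y where "\<sigma> * a < y" "y < \<sigma> * b" "poly (heat_poly g t) y = 0"
      using poly_IVT[OF ord(1) sgn[OF \<sigma>(2)]] by blast
    moreover have "poly (heat_poly g t) (\<sigma> * (-b)) * poly (heat_poly g t) (\<sigma> * (-a)) < 0"
      using \<sigma>(3) by (intro sgn) (simp add: mult.commute)
    then obtain x where "\<sigma> * (-b) < x" "x < \<sigma> * (-a)" "poly (heat_poly g t) x = 0"
      using poly_IVT[OF ord(2)] by blast
    ultimately show "\<exists>x y. -e < x \<and> x < 0 \<and> 0 < y \<and> y < e \<and>
        poly (heat_poly g t) x = 0 \<and> poly (heat_poly g t) y = 0"
      using \<sigma>(4) ord(3) by (intro exI[of _ x] exI[of _ y]) auto
  qed
qed

lemma multiple_zero_splits: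
  assumes "q \<noteq> 0" "(a, T) \<in> singular_points q" "e > 0"
  obtains d where "d > 0" "\<And>t. T - d < t \<Longrightarrow> t < T \<Longrightarrow>
    \<exists>x y. a - e < x \<and> x < a \<and> a < y \<and> y < a + e \<and> poly (heat_poly q t) x = 0 \<and> poly (heat_poly q t) y = 0"
proof -
  define g where "g = pcompose (heat_poly q T) [:a, 1:]"
  have g: "poly (heat_poly q t) x = poly (heat_poly g (t - T)) (x - a)" for x t
    using heat_poly_recentre[of q T "t - T" a "x - a"] by (simp add: g_def)
  have "pderiv g = pcompose (heat_poly (pderiv q) T) [:a, 1:]"
    by (simp add: g_def pderiv_pcompose pderiv_pCons pderiv_heat_poly)
  then have "poly g 0 = 0" "poly (pderiv g) 0 = 0"
    using assms(2) by (simp_all add: g_def singular_points_def poly_pcompose)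
  then have c: "coeff g 0 = 0" "coeff g 1 = 0" by (simp_all add: poly_0_coeff_0 coeff_pderiv)
  have "g \<noteq> 0" using assms pcompose_eq_0[of "heat_poly q T" "[:a, 1:]"] by (auto simp: g_def)
  from multiple_zero_splits_origin[OF this c assms(3)] obtain d where d: "d > 0"
    "\<And>t. -d < t \<and> t < 0 \<Longrightarrow> \<exists>x y. -e < x \<and> x < 0 \<and> 0 < y \<and> y < e \<and>
      poly (heat_poly g t) x = 0 \<and> poly (heat_poly g t) y = 0"
    by blast
  show ?thesis
  proof (rule that[OF d(1)])
    fix t assume "T - d < t" "t < T"
    then obtain x y where "-e < x" "x < 0" "0 < y" "y < e"
      "poly (heat_poly g (t - T)) x = 0" "poly (heat_poly g (t - T)) y = 0"
      using d(2)[of "t - T"] by auto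
    then show "\<exists>x y. a - e < x \<and> x < a \<and> a < y \<and> y < a + e \<and>
        poly (heat_poly q t) x = 0 \<and> poly (heat_poly q t) y = 0"
      by (intro exI[of _ "a + x"] exI[of _ "a + y"]) (simp add: g)
  qed
qed

section \<open>Curves of zeros\<close>

text \<open>Only continuity is required, so a zero path, unlike a classical solution, may run
  through singular points.\<close>

definition zero_path :: "real poly \<Rightarrow> (real \<Rightarrow> real) \<Rightarrow> real set \<Rightarrow> bool" where
  "zero_path q z I \<longleftrightarrow> continuous_on I z \<and> (\<forall>t\<in>I. poly (heat_poly q t) (z t) = 0)"

lemma zero_path_subset: "zero_path q z I \<Longrightarrow> J \<subseteq> I \<Longrightarrow> zero_path q z J"
  by (auto simp: zero_path_def intro: continuous_on_subset)

lemma zero_pathD: "zero_path q z I \<Longrightarrow> t \<in> I \<Longrightarrow> poly (heat_poly q t) (z t) = 0"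
  by (simp add: zero_path_def)

section \<open>Maximum principle and forward uniqueness\<close>

lemma poly_second_pderiv_le_0_at_local_max:
  fixes f :: "real poly"
  assumes "d > 0" and max: "\<And>x. \<bar>x - a\<bar> < d \<Longrightarrow> poly f x \<le> poly f a"
  shows "poly (pderiv (pderiv f)) a \<le> 0"
proof (rule ccontr)
  assume "\<not> poly (pderiv (pderiv f)) a \<le> 0"
  then obtain e where e: "e > 0" "\<And>h. 0 < h \<Longrightarrow> h < e \<Longrightarrow> poly (pderiv f) a < poly (pderiv f) (a + h)"
    using DERIV_pos_inc_right[OF poly_DERIV[of "pderiv f" a]] by auto
  have "poly (pderiv f) a = 0"
    using max by (intro DERIV_local_max[OF poly_DERIV assms(1)]) (auto simp: abs_minus_commute)
  define h where "h = min d e / 2"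
  have h: "h > 0" "h < d" "h < e" using assms(1) e(1) by (auto simp: h_def)
  obtain \<xi> where "a < \<xi>" "\<xi> < a + h" "poly f (a + h) - poly f a = h * poly (pderiv f) \<xi>"
    using poly_MVT[of a "a + h" f] h by auto
  moreover from this have "poly (pderiv f) \<xi> > 0"
    using e(2)[of "\<xi> - a"] h \<open>poly (pderiv f) a = 0\<close> by simp
  ultimately have "poly f (a + h) > poly f a" using h by (simp add: algebra_simps)
  with max[of "a + h"] h show False by simp
qed

text \<open>The region may be pinched to the single point \<open>(y s, s)\<close> at the bottom, so the parabolic
  boundary consists of the two curves alone.\<close>

lemma heat_max_principle_between:
  assumes y: "continuous_on {s..T} y" and z: "continuous_on {s..T} z" and "y s = z s"
    and le: "\<And>t. t \<in> {s..T} \<Longrightarrow> y t \<le> z t"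
    and zero: "\<And>t. t \<in> {s..T} \<Longrightarrow> poly (heat_poly r t) (y t) = 0 \<and> poly (heat_poly r t) (z t) = 0"
    and t: "t \<in> {s..T}" "x \<in> {y t..z t}"
  shows "poly (heat_poly r t) x \<le> 0"
proof (rule ccontr)
  assume "\<not> poly (heat_poly r t) x \<le> 0"
  then have pos: "poly (heat_poly r t) x > 0" by simp
  then have "t > s" using t zero[of t] assms(3) by (cases "t = s") auto
  \<comment> \<open>The closed region between the curves, presented as a continuous image of a
    rectangle to make it compact.\<close>
  define K where "K = (\<lambda>(l, t). ((1 - l) * y t + l * z t, t)) ` ({0..1} \<times> {s..T})"
  have "compact K"
    unfolding K_def split_def
    by (intro compact_continuous_image compact_Times compact_Icc continuous_intros
        continuous_on_compose2[OF y] continuous_on_compose2[OF z]) auto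
  have K: "(x, t) \<in> K \<longleftrightarrow> t \<in> {s..T} \<and> x \<in> {y t..z t}" for x t
  proof
    assume "(x, t) \<in> K"
    then obtain l where l: "l \<in> {0..1}" "t \<in> {s..T}" "x = (1 - l) * y t + l * z t"
      by (auto simp: K_def)
    have "0 \<le> l * (z t - y t)" "0 \<le> (1 - l) * (z t - y t)"
      using l le[of t] by (auto intro!: mult_nonneg_nonneg)
    with l show "t \<in> {s..T} \<and> x \<in> {y t..z t}" by (simp add: algebra_simps)
  next
    assume asm: "t \<in> {s..T} \<and> x \<in> {y t..z t}"
    define l where "l = (if y t = z t then 0 else (x - y t) / (z t - y t))"
    have "l \<in> {0..1}" "x = (1 - l) * y t + l * z t"
      using asm le[of t] by (auto simp: l_def field_simps)
    then show "(x, t) \<in> K" using asm unfolding K_def by (intro image_eqI[of _ _ "(l, t)"]) auto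
  qed
  \<comment> \<open>Half the slope that would consume the positive value: subtracting \<epsilon> (t
    - s) keeps it positive while making the time derivative at a spatial maximum strictly
    negative.\<close>
  define \<epsilon> where "\<epsilon> = poly (heat_poly r t) x / (2 * (t - s))"
  have "\<epsilon> * (t - s) = poly (heat_poly r t) x / 2"
  proof -
    have "t - s \<noteq> 0" using \<open>t > s\<close> by simp
    then show ?thesis
      unfolding \<epsilon>_def by (metis nonzero_eq_divide_eq divide_divide_eq_left' times_divide_eq_left)
  qed
  then have \<epsilon>: "\<epsilon> > 0" "\<epsilon> * (t - s) < poly (heat_poly r t) x"
    using pos \<open>t > s\<close> by (auto simp: \<epsilon>_def)
  define v where "v = (\<lambda>p. poly (heat_poly r (snd p)) (fst p) - \<epsilon> * (snd p - s))"
  have "continuous_on K v" unfolding v_def by (intro continuous_intros)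
  moreover have "(x, t) \<in> K" using t K by blast
  ultimately obtain p where p: "p \<in> K" "\<And>p'. p' \<in> K \<Longrightarrow> v p' \<le> v p"
    using continuous_attains_sup[OF \<open>compact K\<close>, of v] by blast
  obtain a \<tau> where a: "p = (a, \<tau>)" by (cases p)
  have \<tau>: "\<tau> \<in> {s..T}" "a \<in> {y \<tau>..z \<tau>}" using p(1) by (simp_all add: a K)
  have "v p > 0" using p(2)[OF \<open>(x, t) \<in> K\<close>] \<epsilon> by (simp add: v_def)
  \<comment> \<open>Positivity at the maximizer keeps it off the two curves, and thus off the
    pinched bottom.\<close>
  then have "poly (heat_poly r \<tau>) a > 0"
    using \<epsilon>(1) \<tau>(1) by (simp add: v_def a) (smt (verit) mult_nonneg_nonneg)
  then have a_int: "y \<tau> < a" "a < z \<tau>"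
    using zero[OF \<tau>(1)] \<tau>(2) by (auto simp: order.order_iff_strict)
  then have "\<tau> > s" using \<tau>(1) assms(3) by (cases "\<tau> = s") auto
  have "poly (pderiv (pderiv (heat_poly r \<tau>))) a \<le> 0"
  proof (rule poly_second_pderiv_le_0_at_local_max)
    show "min (a - y \<tau>) (z \<tau> - a) > 0" using a_int by simp
    fix x' assume "\<bar>x' - a\<bar> < min (a - y \<tau>) (z \<tau> - a)"
    then have "(x', \<tau>) \<in> K" using \<tau>(1) by (auto simp: K)
    from p(2)[OF this] show "poly (heat_poly r \<tau>) x' \<le> poly (heat_poly r \<tau>) a"
      by (simp add: v_def a)
  qed
  then have neg: "poly (heat_poly (pderiv (pderiv r)) \<tau>) a / 2 - \<epsilon> < 0"
    using \<epsilon>(1) by (simp add: pderiv_heat_poly)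
  have "((\<lambda>t. poly (heat_poly r t) a - \<epsilon> * (t - s)) has_real_derivative
      poly (heat_poly (pderiv (pderiv r)) \<tau>) a / 2 - \<epsilon>) (at \<tau>)"
    by (intro DERIV_diff poly_heat_poly_has_field_derivative_time) (auto intro!: derivative_eq_intros)
  \<comment> \<open>A slightly earlier time at the same position gives a larger value of
    \<open>v\<close>; by continuity of the two curves that point is still in \<open>K\<close>, a
    contradiction.\<close>
  from DERIV_neg_dec_left[OF this neg] obtain d where d: "d > 0"
    "\<And>h. 0 < h \<Longrightarrow> h < d \<Longrightarrow> v (a, \<tau>) < v (a, \<tau> - h)"
    by (auto simp: v_def)
  have "\<tau> \<in> {s<..T}" using \<tau> \<open>\<tau> > s\<close> by simp
  then have "(y \<longlongrightarrow> y \<tau>) (at \<tau> within {s..T})" "(z \<longlongrightarrow> z \<tau>) (at \<tau> within {s..T})"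
    using y z \<tau> by (auto simp: continuous_on_def)
  then have "\<forall>\<^sub>F t in at \<tau> within {s..T}. y t < a \<and> a < z t"
    using a_int by (intro eventually_conj order_tendstoD[of _ _ _ a]) auto
  then obtain e where e: "e > 0" "\<And>t. t \<in> {s..T} \<Longrightarrow> t \<noteq> \<tau> \<Longrightarrow> \<bar>t - \<tau>\<bar> < e \<Longrightarrow> y t < a \<and> a < z t"
    unfolding eventually_at by (auto simp: dist_real_def)
  define h where "h = min (min d e) (\<tau> - s) / 2"
  have h: "h > 0" "h < d" "h < e" "h < \<tau> - s" using d e \<open>\<tau> > s\<close> by (auto simp: h_def)
  then have inK: "(a, \<tau> - h) \<in> K"
    using e(2)[of "\<tau> - h"] \<tau> by (auto simp: K)
  from p(2)[OF inK] d(2)[OF h(1,2)] show False by (simp add: a)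
qed

text \<open>Two paths that separate enclose a region pinched at their last meeting time. The maximum
  principle for q and for -q makes the flow vanish on the whole interval between them at time
  \<open>T\<close>, but a nonzero polynomial has finitely many roots. This works across singular
  points as well.\<close>

lemma zero_paths_eq_forward:
  assumes "q \<noteq> 0" "zero_path q y {s..T}" "zero_path q z {s..T}" "y s = z s" "s \<le> T"
  shows "y T = z T"
proof -
  have *: False if y: "zero_path q y {s..T}" and z: "zero_path q z {s..T}"
    and eq: "y s = z s" and lt: "y T < z T" and "s \<le> T" for y z s
  proof -
    define E where "E = {t \<in> {s..T}. z t - y t = 0}"
    have "closed E" unfolding E_def
      using y z by (intro continuous_closed_preimage_constant continuous_intros) (auto simp: zero_path_def)
    moreover have "bounded E" unfolding E_def by (rule bounded_subset[OF compact_imp_bounded[OF compact_Icc]]) auto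
    ultimately have "compact E" by (simp add: compact_eq_bounded_closed)
    have "s \<in> E" using eq \<open>s \<le> T\<close> by (simp add: E_def)
    \<comment> \<open>The last meeting time; after it the difference cannot become nonpositive,
      since by the intermediate value theorem a later meeting would follow.\<close>
    obtain \<sigma> where \<sigma>: "\<sigma> \<in> E" "\<And>t. t \<in> E \<Longrightarrow> t \<le> \<sigma>"
      using compact_attains_sup[OF \<open>compact E\<close>] \<open>s \<in> E\<close> by blast
    have \<sigma>': "\<sigma> \<in> {s..T}" "y \<sigma> = z \<sigma>" using \<sigma>(1) by (auto simp: E_def)
    have less: "y t < z t" if "t \<in> {\<sigma><..T}" for t
    proof (rule ccontr)
      assume "\<not> y t < z t"
      moreover have "continuous_on {t..T} (\<lambda>t. z t - y t)"
        using y z that \<sigma>' unfolding zero_path_def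
        by (intro continuous_intros) (auto elim!: continuous_on_subset)
      ultimately have "\<exists>t'\<ge>t. t' \<le> T \<and> z t' - y t' = 0"
        using IVT'[of "\<lambda>t. z t - y t" t 0 T] lt that by auto
      then obtain t' where "t \<le> t'" "t' \<le> T" "z t' - y t' = 0" by blast
      with \<sigma>(2)[of t'] that \<sigma>' show False by (auto simp: E_def)
    qed
    have le: "y t \<le> z t" if "t \<in> {\<sigma>..T}" for t
      using less[of t] \<sigma>' that by (cases "t = \<sigma>") auto
    have y': "zero_path q y {\<sigma>..T}" and z': "zero_path q z {\<sigma>..T}"
      using y z \<sigma>' by (auto elim!: zero_path_subset)
    have "poly (heat_poly r T) x \<le> 0" if "r = q \<or> r = - q" "x \<in> {y T..z T}" for r x
      using y' z' le \<sigma>' that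
      by (intro heat_max_principle_between[of \<sigma> T y z]) (auto simp: zero_path_def)
    from this[of q] this[of "- q"]
    have "poly (heat_poly q T) x = 0" if "x \<in> {y T..z T}" for x
      using that by (auto intro: antisym)
    then have "{y T..z T} \<subseteq> {x. poly (heat_poly q T) x = 0}" by blast
    moreover have "finite {x. poly (heat_poly q T) x = 0}"
      using assms(1) by (intro poly_roots_finite) simp
    ultimately have "finite {y T..z T}" by (rule finite_subset)
    with lt show False using infinite_Icc[of "y T" "z T"] by blast
  qed
  then show ?thesis using assms by (metis linorder_neqE_linordered_idom)
qed

section \<open>Trapping zero paths, and their limits\<close>

text \<open>The radius is chosen so that at time T the two points at distance e from
  \<open>a\<close> are not zeros. By continuity these walls stay free of zeros for nearby times, so
  a zero path cannot cross them.\<close>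

lemma isolating_radius:
  assumes "q \<noteq> 0" "e0 > 0"
  obtains e d where "0 < e" "e < e0" "d > 0"
    "\<And>x. poly (heat_poly q T) x = 0 \<Longrightarrow> \<bar>x - a\<bar> < e \<Longrightarrow> x = a"
    "\<And>r I t t'. connected I \<Longrightarrow> I \<subseteq> {T - d<..<T + d} \<Longrightarrow> zero_path q r I \<Longrightarrow> t' \<in> I \<Longrightarrow>
       \<bar>r t' - a\<bar> < e \<Longrightarrow> t \<in> I \<Longrightarrow> \<bar>r t - a\<bar> < e"
proof -
  have "finite {x. poly (heat_poly q T) x = 0}"
    using assms(1) by (intro poly_roots_finite) simp
  from finite_set_avoid[OF this, of a] obtain e1 where e1: "e1 > 0"
    "\<And>x. poly (heat_poly q T) x = 0 \<Longrightarrow> x \<noteq> a \<Longrightarrow> e1 \<le> \<bar>x - a\<bar>"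
    by (auto simp: dist_real_def abs_minus_commute)
  define e where "e = min e1 e0 / 2"
  have e: "0 < e" "e < e0" "e < e1" using e1 assms(2) by (auto simp: e_def)
  have "poly (heat_poly q T) (a + e) \<noteq> 0" "poly (heat_poly q T) (a - e) \<noteq> 0"
    using e1(2)[of "a + e"] e1(2)[of "a - e"] e by auto
  then have "\<forall>\<^sub>F t in nhds T. poly (heat_poly q t) (a + e) \<noteq> 0 \<and> poly (heat_poly q t) (a - e) \<noteq> 0"
    by (intro eventually_conj
        tendsto_imp_eventually_ne[OF tendsto_poly_heat_poly[OF tendsto_const filterlim_ident]])
  then obtain d where d: "d > 0"
    "\<And>t. \<bar>t - T\<bar> < d \<Longrightarrow> poly (heat_poly q t) (a + e) \<noteq> 0 \<and> poly (heat_poly q t) (a - e) \<noteq> 0"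
    unfolding eventually_nhds_metric by (auto simp: dist_real_def)
  show ?thesis
  proof (rule that[OF e(1,2) d(1)])
    show "x = a" if "poly (heat_poly q T) x = 0" "\<bar>x - a\<bar> < e" for x
      using e1(2)[of x] that e by force
  next
    fix r I t t'
    assume I: "connected I" "I \<subseteq> {T - d<..<T + d}" "zero_path q r I" "t' \<in> I" "\<bar>r t' - a\<bar> < e" "t \<in> I"
    show "\<bar>r t - a\<bar> < e"
    proof (rule ccontr)
      assume "\<not> \<bar>r t - a\<bar> < e"
      moreover have "connected ((\<lambda>t. \<bar>r t - a\<bar>) ` I)"
        using I by (intro connected_continuous_image continuous_intros) (auto simp: zero_path_def)
      ultimately have "e \<in> (\<lambda>t. \<bar>r t - a\<bar>) ` I"
        using I by (intro connectedD_interval[of _ "\<bar>r t' - a\<bar>" "\<bar>r t - a\<bar>" e]) auto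
      then obtain \<tau> where "\<tau> \<in> I" "e = \<bar>r \<tau> - a\<bar>" by blast
      then have "r \<tau> = a + e \<or> r \<tau> = a - e" by linarith
      moreover have "poly (heat_poly q \<tau>) (r \<tau>) = 0" using I(3) \<open>\<tau> \<in> I\<close> by (rule zero_pathD)
      moreover have "\<bar>\<tau> - T\<bar> < d" using I(2) \<open>\<tau> \<in> I\<close> by force
      ultimately show False using d(2)[of \<tau>] by auto
    qed
  qed
qed

text \<open>The root bound yields a cluster value along a sequence of times; once the path is close
  to it, the walls of \<open>isolating_radius\<close> trap the whole path, so the cluster value is a
  limit.\<close>

lemma zero_path_limit:
  assumes "q \<noteq> 0" "zero_path q r I" "connected I" "bounded I" "T islimpt I"
  obtains l where "(r \<longlongrightarrow> l) (at T within I)"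
proof -
  obtain A B where AB: "I \<subseteq> {A..B}"
    using assms(4) bounded_subset_cbox_symmetric[of I] by (metis interval_cbox)
  obtain R where R: "\<And>t x. t \<in> {A..B} \<Longrightarrow> poly (heat_poly q t) x = 0 \<Longrightarrow> \<bar>x\<bar> \<le> R"
    using heat_poly_roots_bounded[OF assms(1)] by blast
  obtain f where f: "\<And>n::nat. f n \<in> I - {T}" "f \<longlonglongrightarrow> T"
    using assms(5) unfolding islimpt_sequential by blast
  have "\<bar>r (f n)\<bar> \<le> R" for n
    using f(1)[of n] AB assms(2) by (intro R[of "f n"]) (auto simp: zero_path_def)
  then have "bounded (range (\<lambda>n. r (f n)))" by (auto simp: bounded_iff)
  then obtain l \<phi> where l: "strict_mono (\<phi> :: nat \<Rightarrow> nat)" "(\<lambda>n. r (f (\<phi> n))) \<longlonglongrightarrow> l"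
    by (auto dest!: bounded_imp_convergent_subsequence simp: o_def)
  have f\<phi>: "(\<lambda>n. f (\<phi> n)) \<longlonglongrightarrow> T" using LIMSEQ_subseq_LIMSEQ[OF f(2) l(1)] by (simp add: o_def)
  show ?thesis
  proof (rule that[of l], rule tendstoI)
    fix e0 :: real assume "e0 > 0"
    then obtain e d where ed: "0 < e" "e < e0" "d > 0"
      "\<And>J t t'. connected J \<Longrightarrow> J \<subseteq> {T - d<..<T + d} \<Longrightarrow> zero_path q r J \<Longrightarrow> t' \<in> J \<Longrightarrow>
       \<bar>r t' - l\<bar> < e \<Longrightarrow> t \<in> J \<Longrightarrow> \<bar>r t - l\<bar> < e"
      using isolating_radius[OF assms(1), of e0 T l] by metis
    have "\<forall>\<^sub>F n in sequentially. dist (r (f (\<phi> n))) l < e \<and> dist (f (\<phi> n)) T < d"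
      using ed by (intro eventually_conj tendstoD[OF l(2)] tendstoD[OF f\<phi>])
    then obtain n where n: "\<bar>r (f (\<phi> n)) - l\<bar> < e" "\<bar>f (\<phi> n) - T\<bar> < d"
      by (auto simp: dist_real_def eventually_sequentially)
    define J where "J = I \<inter> {T - d<..<T + d}"
    have "connected J" unfolding J_def
      using assms(3) by (simp flip: is_interval_connected_1 add: is_interval_Int is_interval_oo)
    have "dist (r t) l < e0" if "t \<in> I" "\<bar>t - T\<bar> < d" for t
    proof -
      have "\<bar>r t - l\<bar> < e"
        using n f(1)[of "\<phi> n"] that \<open>connected J\<close> assms(2)
        by (intro ed(4)[of J "f (\<phi> n)" t]) (auto simp: J_def elim!: zero_path_subset)
      then show ?thesis using ed by (simp add: dist_real_def)
    qed
    then show "\<forall>\<^sub>F t in at T within I. dist (r t) l < e0"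
      unfolding eventually_at using ed(3) by (auto simp: dist_real_def)
  qed
qed

section \<open>Persistence and labelling of zeros\<close>

lemma zeros_near_sign_change:
  assumes "x1 < x2" "poly (heat_poly q T) x1 * poly (heat_poly q T) x2 < 0"
  shows "\<forall>\<^sub>F t in nhds T. \<exists>x. x1 < x \<and> x < x2 \<and> poly (heat_poly q t) x = 0"
proof -
  have "((\<lambda>t. poly (heat_poly q t) x1 * poly (heat_poly q t) x2) \<longlongrightarrow>
      poly (heat_poly q T) x1 * poly (heat_poly q T) x2) (nhds T)"
    by (intro tendsto_mult tendsto_poly_heat_poly[OF tendsto_const filterlim_ident])
  from order_tendstoD(2)[OF this assms(2)] show ?thesis
    by eventually_elim (use poly_IVT[OF assms(1)] in blast)
qed

text \<open>Covers degenerate minimizers: for p = x^4 the zero of p' at 0 is not simple, but p'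
  changes sign there, which is enough for a zero to persist.\<close>

definition changes_sign_at :: "real poly \<Rightarrow> real \<Rightarrow> bool" where
  "changes_sign_at f a \<longleftrightarrow>
     (\<forall>e>0. \<exists>x y. a - e < x \<and> x < y \<and> y < a + e \<and> poly f x * poly f y < 0)"

lemma zeros_near_changes_sign_at:
  assumes "changes_sign_at (heat_poly q T) a" "e > 0"
  shows "\<forall>\<^sub>F t in nhds T. \<exists>x. \<bar>x - a\<bar> < e \<and> poly (heat_poly q t) x = 0"
proof -
  obtain x y where "a - e < x" "x < y" "y < a + e" "poly (heat_poly q T) x * poly (heat_poly q T) y < 0"
    using assms unfolding changes_sign_at_def by blast
  from zeros_near_sign_change[OF this(2,4)] show ?thesis
    by eventually_elim (use \<open>a - e < x\<close> \<open>y < a + e\<close> in \<open>force simp: abs_less_iff\<close>)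
qed

lemma changes_sign_at_simple_zero:
  assumes "poly f a = 0" "poly (pderiv f) a \<noteq> 0"
  shows "changes_sign_at f a"
proof -
  have *: "changes_sign_at f a" if f: "poly f a = 0" "poly (pderiv f) a > 0" for f :: "real poly"
    unfolding changes_sign_at_def
  proof (intro allI impI)
    fix e :: real assume "e > 0"
    obtain d1 where d1: "d1 > 0" "\<And>h. 0 < h \<Longrightarrow> h < d1 \<Longrightarrow> poly f (a - h) < 0"
      using DERIV_pos_inc_left[OF poly_DERIV f(2)] f(1) by auto
    obtain d2 where d2: "d2 > 0" "\<And>h. 0 < h \<Longrightarrow> h < d2 \<Longrightarrow> poly f (a + h) > 0"
      using DERIV_pos_inc_right[OF poly_DERIV f(2)] f(1) by auto
    define h where "h = min e (min d1 d2) / 2"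
    have "0 < h" "h < e" "h < d1" "h < d2" using \<open>e > 0\<close> d1(1) d2(1) by (auto simp: h_def)
    with d1(2)[of h] d2(2)[of h]
    show "\<exists>x y. a - e < x \<and> x < y \<and> y < a + e \<and> poly f x * poly f y < 0"
      by (intro exI[of _ "a - h"] exI[of _ "a + h"]) (auto intro: mult_neg_pos)
  qed
  show ?thesis
  proof (cases "poly (pderiv f) a > 0")
    case False
    then have "changes_sign_at (- f) a" using assms by (intro *) (auto simp: pderiv_minus)
    then show ?thesis by (simp add: changes_sign_at_def)
  qed (use * assms in blast)
qed

text \<open>Between two zeros at the same time the space derivative would vanish, but it is nonzero
  in a full neighbourhood of (a, T).\<close>

lemma simple_zero_unique_nearby:
  assumes "poly (heat_poly (pderiv q) T) a \<noteq> 0"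
  shows "\<exists>e>0. \<forall>\<^sub>F t in nhds T. \<forall>x y. \<bar>x - a\<bar> < e \<longrightarrow> \<bar>y - a\<bar> < e \<longrightarrow>
    poly (heat_poly q t) x = 0 \<longrightarrow> poly (heat_poly q t) y = 0 \<longrightarrow> x = y"
proof -
  have "((\<lambda>p. poly (heat_poly (pderiv q) (snd p)) (fst p)) \<longlongrightarrow> poly (heat_poly (pderiv q) T) a)
      (nhds (a, T))"
    by (rule tendsto_poly_heat_poly)
      (use tendsto_fst[OF filterlim_ident[of "nhds (a, T)"]]
        tendsto_snd[OF filterlim_ident[of "nhds (a, T)"]] in simp_all)
  from tendsto_imp_eventually_ne[OF this assms] obtain P Q where
    PQ: "eventually P (nhds a)" "eventually Q (nhds T)"
      "\<And>x t. P x \<Longrightarrow> Q t \<Longrightarrow> poly (heat_poly (pderiv q) t) x \<noteq> 0"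
    unfolding nhds_prod eventually_prod_filter by auto
  from PQ(1) obtain e where e: "e > 0" "\<And>x. \<bar>x - a\<bar> < e \<Longrightarrow> P x"
    unfolding eventually_nhds_metric by (auto simp: dist_real_def)
  have *: False if "Q t" "\<bar>x - a\<bar> < e" "\<bar>y - a\<bar> < e" "poly (heat_poly q t) x = 0"
    "poly (heat_poly q t) y = 0" "x < y" for t x y
  proof -
    obtain \<xi> where "x < \<xi>" "\<xi> < y"
      "poly (heat_poly q t) y - poly (heat_poly q t) x = (y - x) * poly (pderiv (heat_poly q t)) \<xi>"
      using poly_MVT[OF \<open>x < y\<close>, of "heat_poly q t"] by blast
    with PQ(3)[of \<xi> t] e(2)[of \<xi>] that show False by (auto simp: pderiv_heat_poly)
  qed
  show ?thesis
  proof (intro exI[of _ e] conjI e(1))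
    show "\<forall>\<^sub>F t in nhds T. \<forall>x y. \<bar>x - a\<bar> < e \<longrightarrow> \<bar>y - a\<bar> < e \<longrightarrow>
        poly (heat_poly q t) x = 0 \<longrightarrow> poly (heat_poly q t) y = 0 \<longrightarrow> x = y"
      using PQ(2) by eventually_elim (metis * linorder_neqE_linordered_idom)
  qed
qed

text \<open>Zeros that stay \<open>e\<close> away from all zeros at time T form a compact set in the
  plane; its projection to the time axis misses T, hence a neighbourhood of T.\<close>

lemma zeros_near_zeros:
  assumes "q \<noteq> 0" "e > 0"
  shows "\<forall>\<^sub>F t in nhds T. \<forall>x. poly (heat_poly q t) x = 0 \<longrightarrow>
     (\<exists>a. poly (heat_poly q T) a = 0 \<and> \<bar>x - a\<bar> < e)"
proof -
  obtain R where R: "\<And>t x. t \<in> {T - 1..T + 1} \<Longrightarrow> poly (heat_poly q t) x = 0 \<Longrightarrow> \<bar>x\<bar> \<le> R"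
    using heat_poly_roots_bounded[OF assms(1)] by blast
  define C where "C = {-R..R} - (\<Union>a\<in>{a. poly (heat_poly q T) a = 0}. ball a e)"
  have "compact C" unfolding C_def by (intro compact_diff compact_Icc open_UN ballI open_ball)
  define K where "K = (C \<times> {T - 1..T + 1}) \<inter> {p. poly (heat_poly q (snd p)) (fst p) = 0}"
  have "compact K" unfolding K_def
    by (intro compact_Int_closed compact_Times \<open>compact C\<close> compact_Icc closed_Collect_eq continuous_intros)
  then have "compact (snd ` K)" by (intro compact_continuous_image continuous_intros)
  then have "open (- (snd ` K))" by (simp add: compact_imp_closed open_Compl)
  moreover have "T \<in> - (snd ` K)"
  proof -
    have False if "p \<in> K" "snd p = T" for p
    proof -
      have "fst p \<notin> ball (fst p) e" using that by (auto simp: K_def C_def)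
      with assms(2) show False by simp
    qed
    then show ?thesis by auto
  qed
  ultimately have "\<forall>\<^sub>F t in nhds T. t \<in> - (snd ` K)" by (rule eventually_nhds_in_open)
  moreover have "\<forall>\<^sub>F t in nhds T. t \<in> {T - 1<..<T + 1}" by (intro eventually_nhds_in_open) auto
  ultimately show ?thesis
  proof eventually_elim
    case (elim t)
    show ?case
    proof (intro allI impI)
      fix x assume x: "poly (heat_poly q t) x = 0"
      then have "\<bar>x\<bar> \<le> R" using elim by (intro R[of t]) auto
      have "(x, t) \<notin> K" using elim by force
      then have "x \<notin> C" using x elim by (auto simp: K_def)
      then show "\<exists>a. poly (heat_poly q T) a = 0 \<and> \<bar>x - a\<bar> < e"
        using \<open>\<bar>x\<bar> \<le> R\<close> by (auto simp: C_def dist_real_def abs_minus_commute)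
    qed
  qed
qed

text \<open>Sorting labels the zeros, so the k-th entry as a function of time is a candidate
  branch.\<close>

definition heat_zeros :: "real poly \<Rightarrow> real \<Rightarrow> real list" where
  "heat_zeros q t = sorted_list_of_set {x. poly (heat_poly q t) x = 0}"

lemma set_heat_zeros: "q \<noteq> 0 \<Longrightarrow> set (heat_zeros q t) = {x. poly (heat_poly q t) x = 0}"
  by (simp add: heat_zeros_def poly_roots_finite)

lemma sorted_list_of_set_strict_mono_image:
  assumes "finite A" "strict_mono_on A f"
  shows "sorted_list_of_set (f ` A) = map f (sorted_list_of_set A)"
proof -
  have "sorted_wrt (<) (map f (sorted_list_of_set A))"
    unfolding sorted_wrt_map
    by (rule sorted_wrt_mono_rel[OF _ strict_sorted_list_of_set])
      (use assms in \<open>auto simp: strict_mono_on_def\<close>)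
  moreover have "inj_on f A" using assms(2) by (rule strict_mono_on_imp_inj_on)
  ultimately show ?thesis
    using assms(1) by (subst sorted_list_of_set_unique[symmetric]) (auto simp: card_image)
qed

text \<open>At a regular time all zeros are simple: each persists, none is doubled nearby, and no
  new ones appear. The old zeros are further apart than twice the displacement, so old and new zeros
  correspond in order and the labels are preserved.\<close>

lemma heat_zeros_stable:
  assumes "q \<noteq> 0" "T \<notin> snd ` singular_points q" "e > 0"
  shows "\<forall>\<^sub>F t in nhds T. length (heat_zeros q t) = length (heat_zeros q T) \<and>
     (\<forall>k<length (heat_zeros q T). \<bar>heat_zeros q t ! k - heat_zeros q T ! k\<bar> < e)"
proof -
  define Z where "Z = {x. poly (heat_poly q T) x = 0}"
  have "finite Z" using assms(1) by (simp add: Z_def poly_roots_finite)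
  have simple: "poly (heat_poly (pderiv q) T) a \<noteq> 0" if "a \<in> Z" for a
    using that assms(2) by (force simp: singular_points_def Z_def image_iff)
  let ?U = "\<lambda>a e t. \<forall>x y. \<bar>x - a\<bar> < e \<longrightarrow> \<bar>y - a\<bar> < e \<longrightarrow>
    poly (heat_poly q t) x = 0 \<longrightarrow> poly (heat_poly q t) y = 0 \<longrightarrow> x = y"
  have "\<forall>a\<in>Z. \<exists>e>0. \<forall>\<^sub>F t in nhds T. ?U a e t"
    using simple_zero_unique_nearby simple by blast
  from bchoice[OF this] obtain e0 where
    e0: "\<And>a. a \<in> Z \<Longrightarrow> e0 a > 0 \<and> (\<forall>\<^sub>F t in nhds T. ?U a (e0 a) t)" by blast
  define e1 where "e1 = Min (insert e (e0 ` Z))"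
  have e1: "e1 > 0" "e1 \<le> e" "\<And>a. a \<in> Z \<Longrightarrow> e1 \<le> e0 a"
    using \<open>finite Z\<close> e0 assms(3) by (auto simp: e1_def)
  have U: "\<forall>\<^sub>F t in nhds T. ?U a e1 t" if "a \<in> Z" for a
  proof -
    have "\<forall>\<^sub>F t in nhds T. ?U a (e0 a) t" using e0[OF that] by blast
    then show ?thesis by eventually_elim (use e1(3)[OF that] in \<open>meson less_le_trans\<close>)
  qed
  \<comment> \<open>Local uniqueness at time T itself: two zeros closer than \<open>e1\<close> would
    coincide.\<close>
  have gap: "e1 \<le> b - a" if "a \<in> Z" "b \<in> Z" "a < b" for a b
  proof (rule ccontr)
    assume "\<not> e1 \<le> b - a"
    with eventually_nhds_x_imp_x[OF U[OF that(1)]] that e1(1) show False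
      by (force simp: Z_def dest: spec[of _ a])
  qed
  have "\<forall>\<^sub>F t in nhds T. \<exists>x. \<bar>x - a\<bar> < e1 / 2 \<and> poly (heat_poly q t) x = 0" if "a \<in> Z" for a
    using that simple[OF that] e1(1)
    by (intro zeros_near_changes_sign_at changes_sign_at_simple_zero) (auto simp: Z_def pderiv_heat_poly)
  then have "\<forall>\<^sub>F t in nhds T. \<forall>a\<in>Z. \<exists>x. \<bar>x - a\<bar> < e1 / 2 \<and> poly (heat_poly q t) x = 0"
    using \<open>finite Z\<close> by (simp add: eventually_ball_finite)
  moreover have "\<forall>\<^sub>F t in nhds T. \<forall>a\<in>Z. ?U a e1 t"
    using U \<open>finite Z\<close> by (simp add: eventually_ball_finite)
  moreover have "\<forall>\<^sub>F t in nhds T. \<forall>x. poly (heat_poly q t) x = 0 \<longrightarrow> (\<exists>a. a \<in> Z \<and> \<bar>x - a\<bar> < e1 / 2)"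
    using zeros_near_zeros[OF assms(1), of "e1 / 2" T] e1(1) by (simp add: Z_def)
  ultimately show ?thesis
  proof eventually_elim
    case (elim t)
    from elim(1) obtain f where f: "\<And>a. a \<in> Z \<Longrightarrow> \<bar>f a - a\<bar> < e1 / 2 \<and> poly (heat_poly q t) (f a) = 0"
      by metis
    have "strict_mono_on Z f"
    proof (rule strict_mono_onI)
      fix a b assume ab: "a \<in> Z" "b \<in> Z" "a < b"
      from f[OF ab(1)] f[OF ab(2)] gap[OF ab] show "f a < f b" by linarith
    qed
    moreover have "f ` Z = {x. poly (heat_poly q t) x = 0}"
    proof (intro equalityI subsetI)
      fix x assume x: "x \<in> {x. poly (heat_poly q t) x = 0}"
      then obtain a where a: "a \<in> Z" "\<bar>x - a\<bar> < e1 / 2" using elim(3) by auto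
      then have "x = f a" using elim(2) f[OF a(1)] x e1(1) by auto
      with a show "x \<in> f ` Z" by blast
    qed (use f in auto)
    ultimately have "heat_zeros q t = map f (heat_zeros q T)"
      using sorted_list_of_set_strict_mono_image[OF \<open>finite Z\<close>, of f] by (simp add: heat_zeros_def Z_def)
    moreover have "heat_zeros q T ! k \<in> Z" if "k < length (heat_zeros q T)" for k
      using nth_mem[OF that] assms(1) by (simp add: set_heat_zeros Z_def)
    ultimately show ?case using f e1 by force
  qed
qed

section \<open>Zero branches across strips of regular times\<close>

text \<open>The number of zeros is locally constant, hence constant on the open strip, so the k-th
  zero is a continuous branch. It has limits at both ends, which may be singular times, and extends
  to the closed strip.\<close>

lemma zero_path_through_regular_strip:
  assumes "q \<noteq> 0" and regular: "\<And>t. \<alpha> < t \<Longrightarrow> t < \<beta> \<Longrightarrow> t \<notin> snd ` singular_points q"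
    and t': "\<alpha> < t'" "t' < \<beta>" and b: "poly (heat_poly q t') b = 0"
  obtains r where "zero_path q r {\<alpha>..\<beta>}" "r t' = b"
proof -
  let ?L = "heat_zeros q" and ?I = "{\<alpha><..<\<beta>}"
  have len: "length (?L t) = length (?L t')" if "t \<in> ?I" for t
  proof (rule connected_local_const[of ?I _ _ "\<lambda>t. length (?L t)"])
    show "\<forall>a\<in>?I. \<forall>\<^sub>F b in at a within ?I. length (?L a) = length (?L b)"
    proof
      fix a assume "a \<in> ?I"
      then have "\<forall>\<^sub>F t in nhds a. length (?L t) = length (?L a)"
        using heat_zeros_stable[OF assms(1) regular, of a 1] by (auto elim: eventually_mono)
      then show "\<forall>\<^sub>F b in at a within ?I. length (?L a) = length (?L b)"
        unfolding eventually_at_filter by eventually_elim simp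
    qed
  qed (use that t' in auto)
  from b have "b \<in> set (?L t')" using assms(1) by (simp add: set_heat_zeros)
  then obtain k where k: "k < length (?L t')" "b = ?L t' ! k" by (metis in_set_conv_nth)
  define r0 where "r0 = (\<lambda>t. ?L t ! k)"
  have path: "zero_path q r0 ?I"
    unfolding zero_path_def
  proof (intro conjI ballI)
    show "continuous_on ?I r0"
      unfolding continuous_on_def
    proof (intro ballI tendstoI)
      fix t e :: real assume "t \<in> ?I" "e > 0"
      then have "\<forall>\<^sub>F s in nhds t. dist (r0 s) (r0 t) < e"
        using heat_zeros_stable[OF assms(1) regular, of t e] k(1) len[of t]
        by (auto simp: r0_def dist_real_def elim: eventually_mono)
      then show "\<forall>\<^sub>F s in at t within ?I. dist (r0 s) (r0 t) < e"
        unfolding eventually_at_filter by eventually_elim simp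
    qed
    fix t assume "t \<in> ?I"
    then have "r0 t \<in> set (?L t)" using k(1) len[of t] by (simp add: r0_def)
    then show "poly (heat_poly q t) (r0 t) = 0" using assms(1) by (simp add: set_heat_zeros)
  qed
  have "\<alpha> < \<beta>" using t' by simp
  then have lim\<alpha>: "\<alpha> islimpt ?I" and lim\<beta>: "\<beta> islimpt ?I"
    by (simp_all add: islimpt_greaterThanLessThan1 islimpt_greaterThanLessThan2)
  obtain la where la: "(r0 \<longlongrightarrow> la) (at \<alpha> within ?I)"
    using zero_path_limit[OF assms(1) path _ _ lim\<alpha>] by auto
  obtain lb where lb: "(r0 \<longlongrightarrow> lb) (at \<beta> within ?I)"
    using zero_path_limit[OF assms(1) path _ _ lim\<beta>] by auto
  have end_zero: "poly (heat_poly q T) l = 0" if "(r0 \<longlongrightarrow> l) (at T within ?I)" "T islimpt ?I" for T l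
  proof -
    have "((\<lambda>t. poly (heat_poly q t) (r0 t)) \<longlongrightarrow> poly (heat_poly q T) l) (at T within ?I)"
      by (intro tendsto_poly_heat_poly that tendsto_ident_at)
    moreover have "((\<lambda>t. poly (heat_poly q t) (r0 t)) \<longlongrightarrow> 0) (at T within ?I)"
      by (rule tendsto_eventually)
        (use path in \<open>auto simp: eventually_at_filter zero_path_def intro!: always_eventually\<close>)
    moreover have "at T within ?I \<noteq> bot" using that(2) by (simp add: trivial_limit_within)
    ultimately show ?thesis by (metis tendsto_unique)
  qed
  define r where "r = (\<lambda>t. if t \<le> \<alpha> then la else if t \<ge> \<beta> then lb else r0 t)"
  have "continuous_on {\<alpha>..\<beta>} r"
  proof (rule continuous_on_IccI)
    show "(r \<longlongrightarrow> r \<alpha>) (at_right \<alpha>)"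
    proof -
      have "\<forall>\<^sub>F t in at \<alpha> within ?I. r0 t = r t"
        unfolding eventually_at_filter by (intro always_eventually) (auto simp: r_def)
      with la have "(r \<longlongrightarrow> la) (at \<alpha> within ?I)" by (rule Lim_transform_eventually)
      moreover have "at \<alpha> within ?I = at_right \<alpha>"
        using \<open>\<alpha> < \<beta>\<close> by (intro at_within_nhd[of _ "{..<\<beta>}"]) auto
      ultimately show ?thesis by (simp add: r_def)
    qed
    show "(r \<longlongrightarrow> r \<beta>) (at_left \<beta>)"
    proof -
      have "\<forall>\<^sub>F t in at \<beta> within ?I. r0 t = r t"
        unfolding eventually_at_filter by (intro always_eventually) (auto simp: r_def)
      with lb have "(r \<longlongrightarrow> lb) (at \<beta> within ?I)" by (rule Lim_transform_eventually)
      moreover have "at \<beta> within ?I = at_left \<beta>"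
        using \<open>\<alpha> < \<beta>\<close> by (intro at_within_nhd[of _ "{\<alpha><..}"]) auto
      ultimately show ?thesis using \<open>\<alpha> < \<beta>\<close> by (simp add: r_def)
    qed
    show "(r \<longlongrightarrow> r t) (at t)" if "\<alpha> < t" "t < \<beta>" for t
    proof -
      have t: "t \<in> ?I" using that by simp
      have "(r0 \<longlongrightarrow> r0 t) (at t within ?I)"
        using path t by (auto simp: zero_path_def continuous_on_def)
      moreover have "\<forall>\<^sub>F s in at t within ?I. r0 s = r s"
        unfolding eventually_at_filter by (intro always_eventually) (auto simp: r_def)
      ultimately have "(r \<longlongrightarrow> r0 t) (at t within ?I)" by (rule Lim_transform_eventually)
      then show ?thesis using that t by (simp add: r_def at_within_open[OF t])
    qed
  qed fact
  moreover have "poly (heat_poly q t) (r t) = 0" if t: "t \<in> {\<alpha>..\<beta>}" for t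
  proof -
    consider "t = \<alpha>" | "t = \<beta>" | "t \<in> ?I" using t by fastforce
    then show ?thesis
    proof cases
      case 1
      then show ?thesis using end_zero[OF la lim\<alpha>] by (simp add: r_def)
    next
      case 2
      then show ?thesis using end_zero[OF lb lim\<beta>] \<open>\<alpha> < \<beta>\<close> by (simp add: r_def)
    next
      case 3
      then show ?thesis using path by (simp add: r_def zero_path_def)
    qed
  qed
  ultimately show ?thesis
    using t' k by (intro that[of r]) (auto simp: zero_path_def r_def r0_def)
qed

text \<open>A branch through a zero near (a, T) is trapped near \<open>a\<close> until time T, where
  \<open>a\<close> is the only available zero. The statement serves both ends of the strip.\<close>

lemma zero_path_to_endpoint:
  assumes "q \<noteq> 0" and regular: "\<And>t. \<alpha> < t \<Longrightarrow> t < \<beta> \<Longrightarrow> t \<notin> snd ` singular_points q"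
    and T: "T \<in> {\<alpha>..\<beta>}"
  shows "\<exists>e>0. \<exists>d>0. \<forall>t x. \<alpha> < t \<longrightarrow> t < \<beta> \<longrightarrow> \<bar>t - T\<bar> < d \<longrightarrow> \<bar>x - a\<bar> < e \<longrightarrow>
     poly (heat_poly q t) x = 0 \<longrightarrow> (\<exists>r. zero_path q r {\<alpha>..\<beta>} \<and> r t = x \<and> r T = a)"
proof -
  obtain e d where ed: "0 < e" "d > 0"
    "\<And>x. poly (heat_poly q T) x = 0 \<Longrightarrow> \<bar>x - a\<bar> < e \<Longrightarrow> x = a"
    "\<And>r I t t'. connected I \<Longrightarrow> I \<subseteq> {T - d<..<T + d} \<Longrightarrow> zero_path q r I \<Longrightarrow> t' \<in> I \<Longrightarrow>
       \<bar>r t' - a\<bar> < e \<Longrightarrow> t \<in> I \<Longrightarrow> \<bar>r t - a\<bar> < e"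
    using isolating_radius[OF assms(1), of 1 T a] by (metis zero_less_one)
  have "\<exists>r. zero_path q r {\<alpha>..\<beta>} \<and> r t = x \<and> r T = a"
    if t: "\<alpha> < t" "t < \<beta>" "\<bar>t - T\<bar> < d" and x: "\<bar>x - a\<bar> < e" "poly (heat_poly q t) x = 0" for t x
  proof -
    obtain r where r: "zero_path q r {\<alpha>..\<beta>}" "r t = x"
      using zero_path_through_regular_strip[OF assms(1) regular t(1,2) x(2)] by blast
    have "\<bar>r T - a\<bar> < e"
    proof (rule ed(4)[of "{min t T..max t T}" r t T])
      show "zero_path q r {min t T..max t T}"
        using r(1) t T by (elim zero_path_subset) auto
    qed (use t T r x in \<open>auto simp: min_def max_def\<close>)
    then have "r T = a" using zero_pathD[OF r(1) T] ed(3) by blast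
    with r show ?thesis by blast
  qed
  with ed(1,2) show ?thesis by blast
qed

text \<open>A sign change provides a zero shortly after \<alpha>, whose branch must start at
  \<open>a\<close>. A mere zero could disappear: x^2 flows to x^2 + t.\<close>

lemma zero_path_leaving:
  assumes "q \<noteq> 0" "\<alpha> < \<beta>" and regular: "\<And>t. \<alpha> < t \<Longrightarrow> t < \<beta> \<Longrightarrow> t \<notin> snd ` singular_points q"
    and "changes_sign_at (heat_poly q \<alpha>) a"
  obtains r where "zero_path q r {\<alpha>..\<beta>}" "r \<alpha> = a"
proof -
  obtain e d where ed: "e > 0" "d > 0"
    "\<And>t x. \<alpha> < t \<Longrightarrow> t < \<beta> \<Longrightarrow> \<bar>t - \<alpha>\<bar> < d \<Longrightarrow> \<bar>x - a\<bar> < e \<Longrightarrow>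
     poly (heat_poly q t) x = 0 \<Longrightarrow> \<exists>r. zero_path q r {\<alpha>..\<beta>} \<and> r t = x \<and> r \<alpha> = a"
    using zero_path_to_endpoint[OF assms(1) regular, of \<alpha> \<beta> \<alpha> a] assms(2) by force
  obtain d' where d': "d' > 0" "\<And>t. \<bar>t - \<alpha>\<bar> < d' \<Longrightarrow> \<exists>x. \<bar>x - a\<bar> < e \<and> poly (heat_poly q t) x = 0"
    using zeros_near_changes_sign_at[OF assms(4) ed(1)]
    unfolding eventually_nhds_metric by (auto simp: dist_real_def)
  define t where "t = \<alpha> + min (min d d') (\<beta> - \<alpha>) / 2"
  have t: "\<alpha> < t" "t < \<beta>" "\<bar>t - \<alpha>\<bar> < d" "\<bar>t - \<alpha>\<bar> < d'"
    using ed d' assms(2) by (auto simp: t_def min_def field_simps)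
  show ?thesis using ed(3)[OF t(1-3)] d'(2)[OF t(4)] that by blast
qed

text \<open>Just before \<beta> there are zeros on both sides of \<open>a\<close>; their branches
  differ at that time and both end at \<open>a\<close>.\<close>

lemma two_zero_paths_arriving:
  assumes "q \<noteq> 0" "\<alpha> < \<beta>" and regular: "\<And>t. \<alpha> < t \<Longrightarrow> t < \<beta> \<Longrightarrow> t \<notin> snd ` singular_points q"
    and "(a, \<beta>) \<in> singular_points q"
  obtains r1 r2 t where "zero_path q r1 {\<alpha>..\<beta>}" "zero_path q r2 {\<alpha>..\<beta>}" "r1 \<beta> = a" "r2 \<beta> = a"
    "\<alpha> < t" "t < \<beta>" "r1 t \<noteq> r2 t"
proof -
  obtain e d where ed: "e > 0" "d > 0"
    "\<And>t x. \<alpha> < t \<Longrightarrow> t < \<beta> \<Longrightarrow> \<bar>t - \<beta>\<bar> < d \<Longrightarrow> \<bar>x - a\<bar> < e \<Longrightarrow>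
     poly (heat_poly q t) x = 0 \<Longrightarrow> \<exists>r. zero_path q r {\<alpha>..\<beta>} \<and> r t = x \<and> r \<beta> = a"
    using zero_path_to_endpoint[OF assms(1) regular, of \<alpha> \<beta> \<beta> a] assms(2) by force
  obtain d' where d': "d' > 0" "\<And>t. \<beta> - d' < t \<Longrightarrow> t < \<beta> \<Longrightarrow>
    \<exists>x y. a - e < x \<and> x < a \<and> a < y \<and> y < a + e \<and> poly (heat_poly q t) x = 0 \<and> poly (heat_poly q t) y = 0"
    using multiple_zero_splits[OF assms(1,4) ed(1)] by blast
  define t where "t = \<beta> - min (min d d') (\<beta> - \<alpha>) / 2"
  have t: "\<alpha> < t" "t < \<beta>" "\<bar>t - \<beta>\<bar> < d" "\<beta> - d' < t"
    using ed d' assms(2) by (auto simp: t_def min_def field_simps)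
  obtain x y where "a - e < x" "x < a" "a < y" "y < a + e"
    and zero: "poly (heat_poly q t) x = 0" "poly (heat_poly q t) y = 0"
    using d'(2)[OF t(4,2)] by blast
  then have xy: "\<bar>x - a\<bar> < e" "\<bar>y - a\<bar> < e" "x \<noteq> y" by auto
  obtain r1 where "zero_path q r1 {\<alpha>..\<beta>}" "r1 t = x" "r1 \<beta> = a"
    using ed(3)[OF t(1-3) xy(1) zero(1)] by blast
  moreover obtain r2 where "zero_path q r2 {\<alpha>..\<beta>}" "r2 t = y" "r2 \<beta> = a"
    using ed(3)[OF t(1-3) xy(2) zero(2)] by blast
  ultimately show ?thesis using xy(3) t that[of r1 r2 t] by simp
qed

text \<open>No zero arises from nothing: a singular one is reached by the splitting, a simple one by
  persistence of its sign change.\<close>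

lemma zero_path_arriving:
  assumes "q \<noteq> 0" "\<alpha> < \<beta>" and regular: "\<And>t. \<alpha> < t \<Longrightarrow> t < \<beta> \<Longrightarrow> t \<notin> snd ` singular_points q"
    and a: "poly (heat_poly q \<beta>) a = 0"
  obtains r where "zero_path q r {\<alpha>..\<beta>}" "r \<beta> = a"
proof (cases "(a, \<beta>) \<in> singular_points q")
  case True
  from two_zero_paths_arriving[OF assms(1-3) this] that show ?thesis by blast
next
  case False
  then have simple: "changes_sign_at (heat_poly q \<beta>) a"
    using a by (intro changes_sign_at_simple_zero) (auto simp: singular_points_def pderiv_heat_poly)
  obtain e d where ed: "e > 0" "d > 0"
    "\<And>t x. \<alpha> < t \<Longrightarrow> t < \<beta> \<Longrightarrow> \<bar>t - \<beta>\<bar> < d \<Longrightarrow> \<bar>x - a\<bar> < e \<Longrightarrow>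
     poly (heat_poly q t) x = 0 \<Longrightarrow> \<exists>r. zero_path q r {\<alpha>..\<beta>} \<and> r t = x \<and> r \<beta> = a"
    using zero_path_to_endpoint[OF assms(1) regular, of \<alpha> \<beta> \<beta> a] assms(2) by force
  obtain d' where d': "d' > 0" "\<And>t. \<bar>t - \<beta>\<bar> < d' \<Longrightarrow> \<exists>x. \<bar>x - a\<bar> < e \<and> poly (heat_poly q t) x = 0"
    using zeros_near_changes_sign_at[OF simple ed(1)]
    unfolding eventually_nhds_metric by (auto simp: dist_real_def)
  define t where "t = \<beta> - min (min d d') (\<beta> - \<alpha>) / 2"
  have t: "\<alpha> < t" "t < \<beta>" "\<bar>t - \<beta>\<bar> < d" "\<bar>t - \<beta>\<bar> < d'"
    using ed d' assms(2) by (auto simp: t_def min_def field_simps)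
  show ?thesis using ed(3)[OF t(1-3)] d'(2)[OF t(4)] that by blast
qed

section \<open>Induction over the strips between singular times\<close>

lemma last_singular_time:
  fixes T :: real
  assumes "q \<noteq> 0" "0 < T"
  obtains \<alpha> where "0 \<le> \<alpha>" "\<alpha> < T" "\<And>t. \<alpha> < t \<Longrightarrow> t < T \<Longrightarrow> t \<notin> snd ` singular_points q"
    "\<alpha> = 0 \<or> \<alpha> \<in> snd ` singular_points q"
proof -
  \<comment> \<open>0 serves as the default when there is no singular time strictly between 0 and
    T.\<close>
  define S where "S = insert 0 (snd ` singular_points q \<inter> {0<..<T})"
  have "finite (snd ` singular_points q \<inter> {0<..<T})"
    by (rule finite_subset[OF _ finite_singular_times[OF assms(1), of 0 T]]) auto
  then have "finite S" "S \<noteq> {}" by (auto simp: S_def)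
  then have Max: "Max S \<in> S" "\<And>t. t \<in> S \<Longrightarrow> t \<le> Max S" by auto
  show ?thesis
  proof (rule that[of "Max S"])
    show 0: "0 \<le> Max S" by (rule Max(2)) (simp add: S_def)
    have "t < T \<and> (t = 0 \<or> t \<in> snd ` singular_points q)" if "t \<in> S" for t
      using that assms(2) by (auto simp: S_def)
    from this[OF Max(1)]
    show "Max S < T" "Max S = 0 \<or> Max S \<in> snd ` singular_points q" by blast+
    fix t assume t: "Max S < t" "t < T"
    then have "t \<notin> S" using Max(2)[of t] by auto
    with t 0 show "t \<notin> snd ` singular_points q" by (auto simp: S_def)
  qed
qed

text \<open>Induction on the number of singular times in the open interval (0, T); each step crosses
  one strip whose interior is regular.\<close>

lemma regular_strip_induct:
  fixes T :: real
  assumes "q \<noteq> 0" "0 \<le> T" and base: "P 0"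
    and step: "\<And>\<alpha> \<beta>. 0 \<le> \<alpha> \<Longrightarrow> \<alpha> < \<beta> \<Longrightarrow>
       (\<And>t. \<alpha> < t \<Longrightarrow> t < \<beta> \<Longrightarrow> t \<notin> snd ` singular_points q) \<Longrightarrow> P \<alpha> \<Longrightarrow> P \<beta>"
  shows "P T"
  using assms(2)
proof (induction "card (snd ` singular_points q \<inter> {0<..<T})" arbitrary: T rule: less_induct)
  case less
  show ?case
  proof (cases "T = 0")
    case False
    with less.prems obtain \<alpha> where \<alpha>: "0 \<le> \<alpha>" "\<alpha> < T"
      "\<And>t. \<alpha> < t \<Longrightarrow> t < T \<Longrightarrow> t \<notin> snd ` singular_points q"
      "\<alpha> = 0 \<or> \<alpha> \<in> snd ` singular_points q"
      using last_singular_time[OF assms(1), of T] by (metis order_le_less)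
    have "P \<alpha>"
    proof (cases "\<alpha> = 0")
      case False
      have "card (snd ` singular_points q \<inter> {0<..<\<alpha>}) < card (snd ` singular_points q \<inter> {0<..<T})"
      proof (rule psubset_card_mono)
        show "finite (snd ` singular_points q \<inter> {0<..<T})"
          by (rule finite_subset[OF _ finite_singular_times[OF assms(1), of 0 T]]) auto
        have "\<alpha> \<in> snd ` singular_points q \<inter> {0<..<T}" using \<alpha> False by auto
        moreover have "\<alpha> \<notin> {0<..<\<alpha>}" by simp
        moreover have "{0<..<\<alpha>} \<subseteq> {0<..<T}" using \<alpha> by auto
        ultimately show "snd ` singular_points q \<inter> {0<..<\<alpha>} \<subset> snd ` singular_points q \<inter> {0<..<T}"
          by blast
      qed
      then show ?thesis using \<alpha>(1) by (rule less.hyps)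
    qed (use base in simp)
    with \<alpha>(1-3) show ?thesis by (rule step)
  qed (use base in simp)
qed

lemma zero_path_glue:
  assumes "zero_path q x {0..\<alpha>}" "zero_path q r {\<alpha>..\<beta>}" "x \<alpha> = r \<alpha>" "0 \<le> \<alpha>" "\<alpha> \<le> \<beta>"
  shows "zero_path q (\<lambda>t. if t \<le> \<alpha> then x t else r t) {0..\<beta>}"
proof -
  have "continuous_on ({0..\<alpha>} \<union> {\<alpha>..\<beta>}) (\<lambda>t. if t \<le> \<alpha> then x t else r t)"
    using assms by (intro continuous_on_cases) (auto simp: zero_path_def)
  moreover have "{0..\<alpha>} \<union> {\<alpha>..\<beta>} = {0..\<beta>}" using assms by auto
  ultimately show ?thesis using assms by (auto simp: zero_path_def)
qed

lemma zero_path_backward: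
  assumes "q \<noteq> 0" "0 \<le> T" "poly (heat_poly q T) a = 0"
  shows "\<exists>z. zero_path q z {0..T} \<and> z T = a"
proof -
  have "\<forall>a. poly (heat_poly q T) a = 0 \<longrightarrow> (\<exists>z. zero_path q z {0..T} \<and> z T = a)"
  proof (rule regular_strip_induct[OF assms(1,2)])
    show "\<forall>a. poly (heat_poly q 0) a = 0 \<longrightarrow> (\<exists>z. zero_path q z {0..0} \<and> z 0 = a)"
      by (auto simp: zero_path_def)
  next
    fix \<alpha> \<beta> :: real
    assume \<alpha>: "0 \<le> \<alpha>" "\<alpha> < \<beta>" "\<And>t. \<alpha> < t \<Longrightarrow> t < \<beta> \<Longrightarrow> t \<notin> snd ` singular_points q"
      and IH: "\<forall>a. poly (heat_poly q \<alpha>) a = 0 \<longrightarrow> (\<exists>z. zero_path q z {0..\<alpha>} \<and> z \<alpha> = a)"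
    show "\<forall>a. poly (heat_poly q \<beta>) a = 0 \<longrightarrow> (\<exists>z. zero_path q z {0..\<beta>} \<and> z \<beta> = a)"
    proof (intro allI impI)
      fix a assume "poly (heat_poly q \<beta>) a = 0"
      then obtain r where r: "zero_path q r {\<alpha>..\<beta>}" "r \<beta> = a"
        using zero_path_arriving[OF assms(1) \<alpha>(2,3)] by blast
      have "poly (heat_poly q \<alpha>) (r \<alpha>) = 0" using r(1) \<alpha> by (intro zero_pathD[OF r(1)]) auto
      then obtain z where z: "zero_path q z {0..\<alpha>}" "z \<alpha> = r \<alpha>" using IH by blast
      show "\<exists>z. zero_path q z {0..\<beta>} \<and> z \<beta> = a"
        using zero_path_glue[OF z(1) r(1) z(2)] \<alpha>(1,2) r(2)
        by (intro exI[of _ "\<lambda>t. if t \<le> \<alpha> then z t else r t"]) auto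
    qed
  qed
  with assms(3) show ?thesis by blast
qed

text \<open>Of the two branches arriving at the singular point at least one differs from
  \<open>x\<close>. Traced back to time 0 it starts elsewhere, for otherwise forward uniqueness
  would identify it with \<open>x\<close>.\<close>

lemma zero_path_to_singular_point_met:
  assumes "q \<noteq> 0" "0 < T" "zero_path q x {0..T}" "(x T, T) \<in> singular_points q"
  obtains z where "zero_path q z {0..T}" "z T = x T" "z 0 \<noteq> x 0"
proof -
  obtain \<alpha> where \<alpha>: "0 \<le> \<alpha>" "\<alpha> < T" "\<And>t. \<alpha> < t \<Longrightarrow> t < T \<Longrightarrow> t \<notin> snd ` singular_points q"
    using last_singular_time[OF assms(1,2)] by metis
  obtain r t where r: "zero_path q r {\<alpha>..T}" "r T = x T" "\<alpha> < t" "t < T" "r t \<noteq> x t"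
    using two_zero_paths_arriving[OF assms(1) \<alpha>(2,3) assms(4)] by metis
  have "poly (heat_poly q \<alpha>) (r \<alpha>) = 0" using \<alpha> by (intro zero_pathD[OF r(1)]) auto
  then obtain z0 where z0: "zero_path q z0 {0..\<alpha>}" "z0 \<alpha> = r \<alpha>"
    using zero_path_backward[OF assms(1) \<alpha>(1)] by blast
  define z where "z = (\<lambda>t. if t \<le> \<alpha> then z0 t else r t)"
  have z: "zero_path q z {0..T}"
    unfolding z_def using zero_path_glue[OF z0(1) r(1) z0(2)] \<alpha> by simp
  have "z 0 \<noteq> x 0"
  proof
    assume "z 0 = x 0"
    then have "z t = x t"
      using r \<alpha> by (intro zero_paths_eq_forward[OF assms(1), of z 0 t x]
          zero_path_subset[OF z] zero_path_subset[OF assms(3)]) auto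
    with r show False by (simp add: z_def)
  qed
  with z r(2) \<alpha>(2) show ?thesis by (intro that[of z]) (auto simp: z_def)
qed

text \<open>The path is continued strip by strip: at time 0 the assumed sign change allows it to
  leave, later the simplicity of the zero reached does.\<close>

lemma zero_path_forward:
  assumes "q \<noteq> 0" "0 \<le> T" "poly q a = 0" "changes_sign_at q a"
    and simple: "\<And>t x. 0 < t \<Longrightarrow> zero_path q x {0..t} \<Longrightarrow> x 0 = a \<Longrightarrow> (x t, t) \<notin> singular_points q"
  shows "\<exists>x. zero_path q x {0..T} \<and> x 0 = a"
proof (rule regular_strip_induct[OF assms(1,2)])
  show "\<exists>x. zero_path q x {0..0} \<and> x 0 = a"
    using assms(3) by (auto simp: zero_path_def)
next
  fix \<alpha> \<beta> :: real
  assume \<alpha>: "0 \<le> \<alpha>" "\<alpha> < \<beta>" "\<And>t. \<alpha> < t \<Longrightarrow> t < \<beta> \<Longrightarrow> t \<notin> snd ` singular_points q"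
    and "\<exists>x. zero_path q x {0..\<alpha>} \<and> x 0 = a"
  then obtain x where x: "zero_path q x {0..\<alpha>}" "x 0 = a" by blast
  have "changes_sign_at (heat_poly q \<alpha>) (x \<alpha>)"
  proof (cases "\<alpha> = 0")
    case True
    then show ?thesis using x assms(4) by simp
  next
    case False
    then show ?thesis
      using simple[OF _ x] zero_pathD[OF x(1), of \<alpha>] \<alpha>(1)
      by (intro changes_sign_at_simple_zero) (auto simp: singular_points_def pderiv_heat_poly)
  qed
  then obtain r where r: "zero_path q r {\<alpha>..\<beta>}" "r \<alpha> = x \<alpha>"
    using zero_path_leaving[OF assms(1) \<alpha>(2,3)] by blast
  show "\<exists>x. zero_path q x {0..\<beta>} \<and> x 0 = a"
    using zero_path_glue[OF x(1) r(1) r(2)[symmetric]] \<alpha>(1,2) x(2)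
    by (intro exI[of _ "\<lambda>t. if t \<le> \<alpha> then x t else r t"]) auto
qed

text \<open>The earliest time from which the paths agree up to T is attained by continuity. If it
  were positive, local uniqueness at the simple zero would push it further back.\<close>

lemma zero_paths_eq_backward:
  assumes y: "zero_path q y {0..T}" and z: "zero_path q z {0..T}" and "0 \<le> T" "y T = z T"
    and regular: "\<And>t. 0 < t \<Longrightarrow> t \<le> T \<Longrightarrow> (y t, t) \<notin> singular_points q"
  shows "y 0 = z 0"
proof -
  define E where "E = {s \<in> {0..T}. \<forall>t\<in>{s..T}. y t = z t}"
  have "T \<in> E" using assms by (simp add: E_def)
  have bdd: "bdd_below E" by (rule bdd_belowI[of _ 0]) (simp add: E_def)
  define \<sigma> where "\<sigma> = Inf E"
  have \<sigma>: "0 \<le> \<sigma>" "\<sigma> \<le> T"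
    unfolding \<sigma>_def using \<open>T \<in> E\<close> bdd by (auto intro!: cInf_greatest cInf_lower simp: E_def)
  have eq: "y t = z t" if t: "\<sigma> < t" "t \<le> T" for t
  proof -
    obtain s where "s \<in> E" "s < t"
      using cInf_lessD[of E t] \<open>T \<in> E\<close> t by (auto simp: \<sigma>_def)
    with t show ?thesis by (auto simp: E_def)
  qed
  have cont: "continuous_on {0..T} y" "continuous_on {0..T} z" using y z by (simp_all add: zero_path_def)
  have "y \<sigma> = z \<sigma>"
  proof (cases "\<sigma> = T")
    case False
    then have lt: "\<sigma> < T" using \<sigma> by simp
    have lim: "(f \<longlongrightarrow> f \<sigma>) (at_right \<sigma>)" if "continuous_on {0..T} f" for f :: "real \<Rightarrow> real"
    proof -
      have "continuous_on {\<sigma>..T} f" using \<sigma> by (intro continuous_on_subset[OF that]) auto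
      then show ?thesis using lt by (simp add: continuous_on_Icc_at_rightD)
    qed
    have "\<forall>\<^sub>F t in at_right \<sigma>. y t = z t"
      unfolding eventually_at_right_field using lt eq by (intro exI[of _ T]) auto
    from Lim_transform_eventually[OF lim[OF cont(1)] this] lim[OF cont(2)] show ?thesis
      by (rule tendsto_unique[rotated]) simp
  qed (use assms in simp)
  then have \<sigma>E: "\<sigma> \<in> E" using eq \<sigma> by (auto simp: E_def order.order_iff_strict)
  have "\<sigma> = 0"
  proof (rule ccontr)
    assume "\<sigma> \<noteq> 0"
    then have pos: "\<sigma> > 0" using \<sigma> by simp
    then have "poly (heat_poly (pderiv q) \<sigma>) (y \<sigma>) \<noteq> 0"
      using regular[of \<sigma>] zero_pathD[OF y, of \<sigma>] \<sigma> by (simp add: singular_points_def)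
    then obtain e where e: "e > 0" "\<forall>\<^sub>F t in nhds \<sigma>. \<forall>a b. \<bar>a - y \<sigma>\<bar> < e \<longrightarrow> \<bar>b - y \<sigma>\<bar> < e \<longrightarrow>
       poly (heat_poly q t) a = 0 \<longrightarrow> poly (heat_poly q t) b = 0 \<longrightarrow> a = b"
      using simple_zero_unique_nearby by blast
    have "(y \<longlongrightarrow> y \<sigma>) (at \<sigma> within {0..T})" "(z \<longlongrightarrow> y \<sigma>) (at \<sigma> within {0..T})"
      using cont(1)[unfolded continuous_on_def, rule_format, of \<sigma>]
        cont(2)[unfolded continuous_on_def, rule_format, of \<sigma>] \<sigma>
      by (simp_all flip: \<open>y \<sigma> = z \<sigma>\<close>)
    then have "\<forall>\<^sub>F t in at \<sigma> within {0..T}. dist (y t) (y \<sigma>) < e \<and> dist (z t) (y \<sigma>) < e"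
      using e(1) by (intro eventually_conj tendstoD)
    then have "\<forall>\<^sub>F t in nhds \<sigma>. t \<in> {0..T} \<longrightarrow> y t = z t"
      unfolding eventually_at_filter using e(2)
    proof eventually_elim
      case (elim t)
      then show ?case
        using zero_pathD[OF y, of t] zero_pathD[OF z, of t] \<open>y \<sigma> = z \<sigma>\<close>
        by (cases "t = \<sigma>") (auto simp: dist_real_def)
    qed
    then obtain d where d: "d > 0" "\<And>t. \<bar>t - \<sigma>\<bar> < d \<Longrightarrow> t \<in> {0..T} \<Longrightarrow> y t = z t"
      unfolding eventually_nhds_metric by (auto simp: dist_real_def)
    define s where "s = \<sigma> - min d \<sigma> / 2"
    have s: "0 \<le> s" "s < \<sigma>" "\<sigma> - s < d" using d pos by (auto simp: s_def min_def)
    have "y t = z t" if "t \<in> {s..T}" for t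
    proof (cases "t < \<sigma>")
      case True
      then show ?thesis using that s \<sigma> by (intro d(2)) auto
    next
      case False
      then show ?thesis using \<sigma>E that by (simp add: E_def)
    qed
    then have "s \<in> E" using s \<sigma> by (simp add: E_def)
    then have "\<sigma> \<le> s" unfolding \<sigma>_def using bdd by (rule cInf_lower)
    with s show False by simp
  qed
  with \<open>y \<sigma> = z \<sigma>\<close> show ?thesis by simp
qed

section \<open>Yuille--Poggio curves\<close>

text \<open>These are the even central moments of the normal distribution with variance t, written
  in the form of \<open>normal_moment_even\<close>.\<close>

lemma heat_monom_at_0:
  assumes "t > 0"
  shows "heat_monom (2 * j) t 0 = fact (2 * j) / ((2 / t) ^ j * fact j)"
proof (induction j)
  case (Suc j)
  have "heat_monom (2 * Suc j) t 0 = t * (real (2 * j + 1) * heat_monom (2 * j) t 0)"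
    using heat_monom_Suc_Suc[of "2 * j" t 0] by simp
  also have "\<dots> = t * (real (2 * j + 1) * (fact (2 * j) / ((2 / t) ^ j * fact j)))"
    by (simp only: Suc.IH)
  also have "\<dots> = (real (2 * j + 2) * (real (2 * j + 1) * fact (2 * j))) /
      ((2 / t) * (2 / t) ^ j * (real (j + 1) * fact j))"
    using assms by (simp add: divide_simps)
  also have "real (2 * j + 2) * (real (2 * j + 1) * fact (2 * j)) = fact (2 * Suc j)"
    by simp
  also have "real (j + 1) * fact j = fact (Suc j)" by simp
  finally show ?case by simp
qed simp

lemma heat_monom_odd_at_0: "heat_monom (2 * j + 1) t 0 = 0"
proof (induction j)
  case (Suc j)
  then show ?case using heat_monom_Suc_Suc[of "2 * j + 1" t 0] by simp
qed simp

lemma has_bochner_integral_heat_monom: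
  assumes "t > 0"
  shows "has_bochner_integral lborel (\<lambda>y. normal_density x (sqrt t) y * (y - x) ^ k) (heat_monom k t 0)"
proof (cases "even k")
  case True
  then obtain j where "k = 2 * j" by (elim evenE)
  then show ?thesis
    using normal_moment_even[where \<mu> = x and \<sigma> = "sqrt t" and k = j] assms by (simp add: heat_monom_at_0)
next
  case False
  then obtain j where "k = 2 * j + 1" by (elim oddE)
  then show ?thesis
    using normal_moment_odd[where \<mu> = x and \<sigma> = "sqrt t" and k = j] assms
    by (simp only: heat_monom_odd_at_0 real_sqrt_gt_0_iff)
qed

text \<open>Expanding p in powers of y - x turns the convolution into a sum of central Gaussian
  moments; these are the heat polynomials at 0, so the sum is the flow of the recentred polynomial
  at the origin.\<close>

lemma heat_eq_poly_heat_poly: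
  assumes "t \<ge> 0"
  shows "heat p x t = poly (heat_poly p t) x"
proof (cases "t = 0")
  case False
  then have "t > 0" using assms by simp
  define s where "s = pcompose p [:x, 1:]"
  have kernel: "heat_kernel t (x - y) = normal_density x (sqrt t) y" for y
    using \<open>t > 0\<close> by (simp add: heat_kernel_def normal_density_def power2_commute)
  have "poly p y = poly s (y - x)" for y by (simp add: s_def poly_pcompose)
  then have "poly p y = (\<Sum>k\<le>degree s. coeff s k * (y - x) ^ k)" for y by (simp add: poly_altdef)
  then have "poly p y * heat_kernel t (x - y) =
      (\<Sum>k\<le>degree s. coeff s k * (normal_density x (sqrt t) y * (y - x) ^ k))" for y
    by (simp add: kernel sum_distrib_left mult.commute mult.left_commute)
  moreover have "has_bochner_integral lborel
      (\<lambda>y. \<Sum>k\<le>degree s. coeff s k * (normal_density x (sqrt t) y * (y - x) ^ k))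
      (\<Sum>k\<le>degree s. coeff s k * heat_monom k t 0)"
    by (intro has_bochner_integral_sum has_bochner_integral_mult_right
        has_bochner_integral_heat_monom \<open>t > 0\<close>)
  ultimately have "heat p x t = (\<Sum>k\<le>degree s. coeff s k * heat_monom k t 0)"
    using \<open>t > 0\<close> by (simp add: heat_def has_bochner_integral_integral_eq)
  also have "\<dots> = poly (heat_poly p t) x"
    using heat_poly_recentre[of p 0 t x 0]
    by (simp add: poly_heat_poly_eq_sum_heat_monom[of s] flip: s_def)
  finally show ?thesis .
qed (simp add: heat_def)

lemma heat_dx_eq:
  assumes "t \<ge> 0"
  shows "heat_dx n p x t = poly (heat_poly ((pderiv ^^ n) p) t) x"
proof -
  have "(deriv ^^ n) (poly f) = poly ((pderiv ^^ n) f)" for f :: "real poly"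
  proof (induction n)
    case (Suc n)
    have "deriv (poly g) = poly (pderiv g)" for g :: "real poly"
      by (rule ext, rule DERIV_imp_deriv, rule poly_DERIV)
    with Suc show ?case by simp
  qed simp
  then show ?thesis
    using assms by (simp add: heat_dx_def heat_eq_poly_heat_poly higher_pderiv_heat_poly)
qed

section \<open>Trajectories as level curves of the first space derivative\<close>

lemma yp_solution_iff:
  assumes "I \<subseteq> {0..}"
  shows "yp_solution p x I \<longleftrightarrow>
    (\<forall>t\<in>I. poly (heat_poly (pderiv (pderiv p)) t) (x t) \<noteq> 0 \<and>
      (x has_real_derivative - poly (heat_poly (pderiv (pderiv (pderiv p))) t) (x t) /
         (2 * poly (heat_poly (pderiv (pderiv p)) t) (x t))) (at t within I))"
  unfolding yp_solution_def using assms
  by (intro ball_cong refl) (auto simp: heat_dx_eq numeral_2_eq_2 numeral_3_eq_3 subset_iff)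

lemma yp_solution_subset: "yp_solution p x I \<Longrightarrow> J \<subseteq> I \<Longrightarrow> yp_solution p x J"
  unfolding yp_solution_def by (blast intro: DERIV_subset)

text \<open>By the chain rule the equation says exactly that the derivative of p_x along the curve
  is 0; continuity bridges the finitely many exceptional times.\<close>

lemma yp_solution_const:
  assumes "a \<le> b" "0 \<le> a" "continuous_on {a..b} x" "finite S" "yp_solution p x ({a..b} - S)"
  shows "poly (heat_poly (pderiv p) b) (x b) = poly (heat_poly (pderiv p) a) (x a)"
proof (rule has_derivative_zero_unique_strong_interval[OF assms(4), of a b
      "\<lambda>t. poly (heat_poly (pderiv p) t) (x t)"])
  show "continuous_on {a..b} (\<lambda>t. poly (heat_poly (pderiv p) t) (x t))"
    by (intro continuous_intros assms(3))
  fix t assume t: "t \<in> {a..b} - S"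
  \<comment> \<open>A finite set is closed, so removing it does not affect limits at a point outside
    it.\<close>
  have "at t within ({a..b} - S) = at t within {a..b}"
    using t assms(4) by (intro at_within_nhd[of _ "- S"]) (auto simp: finite_imp_closed)
  then have nz: "poly (heat_poly (pderiv (pderiv p)) t) (x t) \<noteq> 0"
    and deriv: "(x has_real_derivative - poly (heat_poly (pderiv (pderiv (pderiv p))) t) (x t) /
         (2 * poly (heat_poly (pderiv (pderiv p)) t) (x t))) (at t within {a..b})"
    using assms(2,5) t by (subst (asm) yp_solution_iff; force)+
  from DERIV_heat_poly_curve[OF deriv, of "pderiv p"] nz
  have "((\<lambda>t. poly (heat_poly (pderiv p) t) (x t)) has_real_derivative 0) (at t within {a..b})"
    by simp
  then show "((\<lambda>t. poly (heat_poly (pderiv p) t) (x t)) has_derivative (\<lambda>h. 0)) (at t within {a..b})"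
    by (simp add: has_field_derivative_def lambda_zero)
qed (use assms(1) in auto)

lemma yp_path_const:
  assumes "yp_path p x T" "0 \<le> t" "t \<le> T"
  shows "poly (heat_poly (pderiv p) t) (x t) = poly (pderiv p) (x 0)"
proof -
  obtain S where S: "continuous_on {0..T} x" "finite S" "yp_solution p x ({0..T} - S)"
    using assms(1) by (auto simp: yp_path_def)
  have "yp_solution p x ({0..t} - S)"
    by (rule yp_solution_subset[OF S(3)]) (use assms(3) in auto)
  moreover have "continuous_on {0..t} x"
    using assms(3) by (intro continuous_on_subset[OF S(1)]) auto
  ultimately show ?thesis
    using yp_solution_const[OF assms(2) _ _ S(2), of x p] by simp
qed

text \<open>All singular times, finite in number, serve as exceptional times, whether or not the
  path itself is singular then.\<close>

lemma yp_path_of_zero_path: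
  assumes "pderiv p \<noteq> 0" "zero_path (pderiv p) x {0..T}"
  shows "yp_path p x T"
proof -
  let ?S = "snd ` singular_points (pderiv p) \<inter> {0..T}"
  have "yp_solution p x ({0..T} - ?S)"
  proof (subst yp_solution_iff)
    show "\<forall>t\<in>{0..T} - ?S. poly (heat_poly (pderiv (pderiv p)) t) (x t) \<noteq> 0 \<and>
      (x has_real_derivative - poly (heat_poly (pderiv (pderiv (pderiv p))) t) (x t) /
         (2 * poly (heat_poly (pderiv (pderiv p)) t) (x t))) (at t within {0..T} - ?S)"
    proof (intro ballI conjI)
      fix t assume t: "t \<in> {0..T} - ?S"
      have path: "zero_path (pderiv p) x ({0..T} - ?S)"
        by (rule zero_path_subset[OF assms(2)]) auto
      show nz: "poly (heat_poly (pderiv (pderiv p)) t) (x t) \<noteq> 0"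
        using zero_pathD[OF path t] t by (force simp: singular_points_def image_iff)
      show "(x has_real_derivative - poly (heat_poly (pderiv (pderiv (pderiv p))) t) (x t) /
         (2 * poly (heat_poly (pderiv (pderiv p)) t) (x t))) (at t within {0..T} - ?S)"
        using path t nz by (intro DERIV_heat_poly_zero_curve) (auto simp: zero_path_def continuous_on_def)
    qed
  qed auto
  with assms show ?thesis
    unfolding yp_path_def zero_path_def using finite_singular_times[OF assms(1), of 0 T] by blast
qed

lemma zero_path_of_yp_path:
  assumes "yp_path p x T" "0 \<le> t" "t \<le> T" "poly (heat_poly (pderiv p) t) (x t) = 0"
  shows "zero_path (pderiv p) x {0..T}"
  using assms yp_path_const[OF assms(1)] by (auto simp: zero_path_def yp_path_def)

section \<open>Critical points and minimizers\<close>

text \<open>A convex graph lies above its tangent, which is horizontal at a critical point; so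
  \<open>b\<close> would be a minimizer as well.\<close>

lemma convex_critical_point_unique:
  assumes convex: "convex_on UNIV (poly h)" and min: "the_global_minimizer (poly h) a"
    and b: "poly (pderiv h) b = 0"
  shows "b = a"
proof (rule ccontr)
  assume "b \<noteq> a"
  have "0 * (a - b) \<le> poly h a - poly h b"
    using b by (intro convex_on_imp_above_tangent[OF convex]) (auto intro: poly_DERIV[of h b, simplified b])
  then have "poly h b \<le> poly h a" by simp
  with min \<open>b \<noteq> a\<close> show False by (auto simp: the_global_minimizer_def not_less)
qed

lemma the_global_minimizer_critical:
  assumes "the_global_minimizer (poly h) a"
  shows "poly (pderiv h) a = 0"
  using assms unfolding the_global_minimizer_def
  by (intro DERIV_local_min[OF poly_DERIV zero_less_one]) (metis order_le_less)

text \<open>The mean value theorem on either side of the strict minimum produces points where the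
  derivative is negative and positive.\<close>

lemma the_global_minimizer_changes_sign:
  assumes "the_global_minimizer (poly h) a"
  shows "changes_sign_at (pderiv h) a"
  unfolding changes_sign_at_def
proof (intro allI impI)
  fix e :: real assume "e > 0"
  have less: "poly h a < poly h (a - e)" "poly h a < poly h (a + e)"
    using assms \<open>e > 0\<close> by (auto simp: the_global_minimizer_def)
  obtain x where x: "a - e < x" "x < a" "poly h a - poly h (a - e) = (a - (a - e)) * poly (pderiv h) x"
    using poly_MVT[of "a - e" a h] \<open>e > 0\<close> by auto
  obtain y where y: "a < y" "y < a + e" "poly h (a + e) - poly h a = (a + e - a) * poly (pderiv h) y"
    using poly_MVT[of a "a + e" h] \<open>e > 0\<close> by auto
  have "e * poly (pderiv h) x < 0" "e * poly (pderiv h) y > 0" using less x(3) y(3) by simp_all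
  then have "poly (pderiv h) x * poly (pderiv h) y < 0"
    using \<open>e > 0\<close> by (simp add: mult_less_0_iff zero_less_mult_iff)
  with x y show "\<exists>x y. a - e < x \<and> x < y \<and> y < a + e \<and> poly (pderiv h) x * poly (pderiv h) y < 0"
    by (intro exI[of _ x] exI[of _ y]) auto
qed

section \<open>The two implications\<close>

lemma escape_zone_imp_inverse_evolution:
  assumes "pderiv p \<noteq> 0" "t0 > 0" and min: "the_global_minimizer (poly p) a"
    and unique: "\<And>b. poly (heat_poly (pderiv p) t0) b = 0 \<Longrightarrow> b = \<xi>"
    and escape: "a \<in> escape_zone p"
  shows "yp_inverse_evolution p \<xi> t0 a"
proof -
  let ?q = "pderiv p"
  \<comment> \<open>A singular point on the zero path from \<open>a\<close> would be reached by a
    second zero path from another start, so that two Yuille-Poggio curves meet.\<close>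
  have simple: "(x t, t) \<notin> singular_points ?q"
    if x: "0 < t" "zero_path ?q x {0..t}" "x 0 = a" for x t
  proof
    assume "(x t, t) \<in> singular_points ?q"
    then obtain z where z: "zero_path ?q z {0..t}" "z t = x t" "z 0 \<noteq> x 0"
      using zero_path_to_singular_point_met[OF assms(1) x(1,2)] by blast
    have "(x t, t) \<in> yp_curve p a"
      unfolding yp_curve_def using x yp_path_of_zero_path[OF assms(1) x(2)] by force
    moreover have "(z t, t) \<in> yp_curve p (z 0)"
      unfolding yp_curve_def using x(1) yp_path_of_zero_path[OF assms(1) z(1)] by force
    ultimately show False using escape z x(3) by (auto simp: escape_zone_def)
  qed
  have "\<exists>x. zero_path ?q x {0..t0} \<and> x 0 = a"
    using assms(2) simple the_global_minimizer_critical[OF min]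
      the_global_minimizer_changes_sign[OF min]
    by (intro zero_path_forward assms(1)) auto
  then obtain x where x: "zero_path ?q x {0..t0}" "x 0 = a" by blast
  have path: "zero_path ?q x {0<..t0}" by (rule zero_path_subset[OF x(1)]) auto
  have "yp_solution p x {0<..t0}"
  proof (subst yp_solution_iff)
    show "\<forall>t\<in>{0<..t0}. poly (heat_poly (pderiv (pderiv p)) t) (x t) \<noteq> 0 \<and>
      (x has_real_derivative - poly (heat_poly (pderiv (pderiv (pderiv p))) t) (x t) /
         (2 * poly (heat_poly (pderiv (pderiv p)) t) (x t))) (at t within {0<..t0})"
    proof (intro ballI conjI)
      fix t assume t: "t \<in> {0<..t0}"
      have "zero_path ?q x {0..t}" using t by (intro zero_path_subset[OF x(1)]) auto
      then show nz: "poly (heat_poly (pderiv (pderiv p)) t) (x t) \<noteq> 0"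
        using simple[of t x] x(2) t zero_pathD[OF path t] by (auto simp: singular_points_def)
      show "(x has_real_derivative - poly (heat_poly (pderiv (pderiv (pderiv p))) t) (x t) /
         (2 * poly (heat_poly (pderiv (pderiv p)) t) (x t))) (at t within {0<..t0})"
        using path t nz by (intro DERIV_heat_poly_zero_curve) (auto simp: zero_path_def continuous_on_def)
    qed
  qed auto
  moreover have "x t0 = \<xi>" using assms(2) by (intro unique zero_pathD[OF x(1)]) auto
  moreover have "(x \<longlongrightarrow> a) (at_right 0)"
    using continuous_on_Icc_at_rightD[of 0 t0 x] x assms(2) by (simp add: zero_path_def)
  ultimately show ?thesis unfolding yp_inverse_evolution_def by blast
qed

text \<open>The trajectory extends to a zero path from \<open>a\<close> that is regular after time
  0. Any meeting of the curve from \<open>a\<close> with another one is transported to a time at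
  most t0, and backward uniqueness along the regular path then identifies the starting
  points.\<close>

lemma inverse_evolution_imp_escape_zone:
  assumes "pderiv p \<noteq> 0" "t0 > 0" and crit: "poly (pderiv p) a = 0"
    and \<xi>: "poly (heat_poly (pderiv p) t0) \<xi> = 0"
    and unique: "\<And>b. poly (heat_poly (pderiv p) t0) b = 0 \<Longrightarrow> b = \<xi>"
    and inv: "yp_inverse_evolution p \<xi> t0 a"
  shows "a \<in> escape_zone p"
proof -
  let ?q = "pderiv p"
  obtain x0 where x0: "yp_solution p x0 {0<..t0}" "x0 t0 = \<xi>" "(x0 \<longlongrightarrow> a) (at_right 0)"
    using inv by (auto simp: yp_inverse_evolution_def)
  have nz: "poly (heat_poly (pderiv ?q) t) (x0 t) \<noteq> 0" if "t \<in> {0<..t0}" for t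
    using x0(1) that by (subst (asm) yp_solution_iff) auto
  have cont0: "continuous_on {0<..t0} x0"
    using x0(1) by (auto simp: yp_solution_def intro: DERIV_continuous_on)
  have zero: "poly (heat_poly ?q t) (x0 t) = 0" if t: "t \<in> {0<..t0}" for t
  proof -
    have "yp_solution p x0 ({t..t0} - {})"
      by (rule yp_solution_subset[OF x0(1)]) (use t in auto)
    moreover have "continuous_on {t..t0} x0" using t by (intro continuous_on_subset[OF cont0]) auto
    ultimately show ?thesis
      using yp_solution_const[of t t0 x0 "{}" p] t x0(2) \<xi> by simp
  qed
  \<comment> \<open>The limit fills in the value at time 0, where the equation may be
    singular.\<close>
  define x where "x = (\<lambda>t. if t \<le> 0 then a else x0 t)"
  have "continuous_on {0..t0} x"
    unfolding continuous_on_def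
  proof
    fix t assume t: "t \<in> {0..t0}"
    show "(x \<longlongrightarrow> x t) (at t within {0..t0})"
    proof (cases "t = 0")
      case True
      have "\<forall>\<^sub>F s in at_right 0. x0 s = x s"
        unfolding eventually_at_filter by (intro always_eventually) (auto simp: x_def)
      from Lim_transform_eventually[OF x0(3) this] show ?thesis
        using True assms(2) by (simp add: x_def at_within_Icc_at_right)
    next
      case False
      with t have t': "t \<in> {0<..t0}" by simp
      have "(x0 \<longlongrightarrow> x0 t) (at t within {0<..t0})" using cont0 t' by (auto simp: continuous_on_def)
      moreover have "\<forall>\<^sub>F s in at t within {0<..t0}. x0 s = x s"
        unfolding eventually_at_filter by (intro always_eventually) (auto simp: x_def)
      ultimately have "(x \<longlongrightarrow> x0 t) (at t within {0<..t0})" by (rule Lim_transform_eventually)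
      moreover have "at t within {0<..t0} = at t within {0..t0}"
        using t' by (intro at_within_nhd[of _ "{0<..}"]) auto
      ultimately show ?thesis using t' by (simp add: x_def)
    qed
  qed
  then have x: "zero_path ?q x {0..t0}"
    unfolding zero_path_def using zero crit by (auto simp: x_def)
  have regular: "(x t, t) \<notin> singular_points ?q" if "0 < t" "t \<le> t0" for t
    using nz[of t] that by (simp add: singular_points_def x_def)
  have disjoint: False
    if c: "c \<noteq> a" and y: "0 \<le> T" "y 0 = a" "yp_path p y T"
      and z: "z 0 = c" "yp_path p z T" "y T = z T" for c T y z
  proof -
    \<comment> \<open>A curve starting at a critical point stays on zeros of p_x, and so does every
      curve meeting it, because p_x is constant along each.\<close>
    have py: "zero_path ?q y {0..T}"
      using y(1,2) crit by (intro zero_path_of_yp_path[OF y(3), of 0]) auto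
    have pz: "zero_path ?q z {0..T}"
      using y(1) z(3) zero_pathD[OF py, of T] by (intro zero_path_of_yp_path[OF z(2), of T]) auto
    \<comment> \<open>If the meeting happens by t0, it is used directly; otherwise both curves
      already pass through the only zero at time t0.\<close>
    define s where "s = min T t0"
    have s: "0 \<le> s" "s \<le> T" "s \<le> t0" using y(1) assms(2) by (auto simp: s_def)
    have xy: "x s = y s"
      using s y(2) by (intro zero_paths_eq_forward[OF assms(1), of x 0 s y]
          zero_path_subset[OF x] zero_path_subset[OF py]) (auto simp: x_def)
    have yz: "y s = z s"
    proof (cases "T \<le> t0")
      case False
      then have "s = t0" by (simp add: s_def)
      then show ?thesis
        using s unique[OF zero_pathD[OF py]] unique[OF zero_pathD[OF pz]] by simp
    qed (use z(3) in \<open>simp add: s_def\<close>)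
    have "x 0 = z 0"
      using s xy yz regular by (intro zero_paths_eq_backward[of ?q x s z]
          zero_path_subset[OF x] zero_path_subset[OF pz]) auto
    with c z(1) show False by (simp add: x_def)
  qed
  show ?thesis
    unfolding escape_zone_def yp_curve_def using disjoint by blast
qed

theorem theorem3p3:
  fixes p :: "real poly" and t0 xmin xstar :: real
  assumes "even (degree p)" and "lead_coeff p > 0"
    and "t0 > 0"
    and "convex_on UNIV (\<lambda>x. heat p x t0)"
    and "the_global_minimizer (\<lambda>x. heat p x t0) xmin"
    and "the_global_minimizer (poly p) xstar"
  shows "yp_inverse_evolution p xmin t0 xstar \<longleftrightarrow> xstar \<in> escape_zone p"
proof -
  have heat: "(\<lambda>x. heat p x t0) = poly (heat_poly p t0)"
    using assms(3) by (simp add: heat_eq_poly_heat_poly)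
  \<comment> \<open>Degree 0 counts as even; constants are excluded by the strictness of the
    minimizer.\<close>
  have nonconst: "pderiv p \<noteq> 0"
  proof
    assume "pderiv p = 0"
    then obtain c where "p = [:c:]" by (auto simp: pderiv_eq_0_iff elim: degree_eq_zeroE)
    then have "poly p xstar = poly p (xstar + 1)" by simp
    then show False using assms(6) unfolding the_global_minimizer_def
      by (metis add_cancel_right_right order_less_irrefl zero_neq_one)
  qed
  have crit: "poly (heat_poly (pderiv p) t0) xmin = 0"
    using the_global_minimizer_critical[of "heat_poly p t0" xmin] assms(5)
    by (simp add: heat pderiv_heat_poly)
  have unique: "b = xmin" if "poly (heat_poly (pderiv p) t0) b = 0" for b
    using convex_critical_point_unique[of "heat_poly p t0" xmin b] assms(4,5) that
    by (simp add: heat pderiv_heat_poly)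
  show ?thesis
    using escape_zone_imp_inverse_evolution[OF nonconst assms(3,6) unique]
      inverse_evolution_imp_escape_zone[OF nonconst assms(3)
        the_global_minimizer_critical[OF assms(6)] crit unique]
    by blast
qed

end
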